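(* Let $G\colon\mathbb{A}^2\to\mathbb{A}^2$ be a Keller map over $\mathbb{C}$. Let $\theta$ and $\eta$ be algebraic actions of $\mathbb{G}_m$ on the source and on the target copy of $\mathbb{A}^2$ respectively, neither assumed diagonal in the given coordinates, with $\theta$ nontrivial, and suppose $$G\circ\theta_t=\eta_t\circ G\qquad\text{for all } t\in\mathbb{G}_m.$$ Then $G$ is a polynomial automorphism. More precisely, there are polynomial automorphisms $\varphi,\psi$ of $\mathbb{A}^2$ such that $\varphi$ carries $\theta$ and $\psi$ carries $\eta$ to diagonal actions $\sigma$ and $\tau$ (that is, $\sigma_t=\varphi\circ\theta_t\circ\varphi^{-1}$ and $\tau_t=\psi\circ\eta_t\circ\psi^{-1}$ are diagonal), with source weights $\mathbf w=(w_1,w_2)$ (the weights of $\sigma$), and $\psi\circ G\circ\varphi^{-1}$ is: (1) triangular if $\mathbf w$ is elliptic, and linear if moreover $w_1=w_2$; (2) affine, if $\mathbf w$ is parabolic; (3) linear, of the form $(x,y)\mapsto(a_0x,b_0y)$ or $(x,y)\mapsto(a_0y,b_0x)$, if $\mathbf w$ is hyperbolic.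
   Context: A Keller map is a polynomial map $\mathbb{C}^n\to\mathbb{C}^n$ whose Jacobian determinant is a nonzero constant. A polynomial automorphism is a bijective polynomial map with polynomial inverse. The diagonal action of $\mathbb{G}_m$ with weights $(w_1,w_2)\in\mathbb{Z}^2$ is $\sigma_t(x,y)=(t^{w_1}x,t^{w_2}y)$. A weight vector is elliptic if its entries are all nonzero and of the same sign, parabolic if some entry vanishes, hyperbolic if all entries are nonzero and both signs occur. *)

theory Defs
  imports Complex_Main "HOL-Computational_Algebra.Polynomial"
begin

text \<open>
  A polynomial in \<open>\<complex>[x,y]\<close> is an element of \<open>complex poly poly\<close>: the outer variable is
  \<open>y\<close> and the coefficients are polynomials in \<open>x\<close>. The plane \<open>\<complex>\<^sup>2\<close> is
  \<open>complex \<times> complex\<close>. As \<open>\<complex>\<close> is infinite, a polynomial map is determined by the function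
  it induces, so maps of the plane are functions here.
\<close>

definition poly2 :: "complex poly poly \<Rightarrow> complex \<Rightarrow> complex \<Rightarrow> complex" where
  "poly2 P x y = poly (poly P [:y:]) x"

definition dx :: "complex poly poly \<Rightarrow> complex poly poly" where
  "dx P = map_poly pderiv P"

definition dy :: "complex poly poly \<Rightarrow> complex poly poly" where
  "dy P = pderiv P"

definition jacobian_det :: "complex poly poly \<Rightarrow> complex poly poly \<Rightarrow> complex poly poly" where
  "jacobian_det P Q = dx P * dy Q - dy P * dx Q"

type_synonym plane_map = "complex \<times> complex \<Rightarrow> complex \<times> complex"

definition map_of_polys :: "complex poly poly \<Rightarrow> complex poly poly \<Rightarrow> plane_map" where
  "map_of_polys P Q = (\<lambda>(x, y). (poly2 P x y, poly2 Q x y))"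

definition poly_map :: "plane_map \<Rightarrow> bool" where
  "poly_map F \<longleftrightarrow> (\<exists>P Q. F = map_of_polys P Q)"

definition keller_map :: "plane_map \<Rightarrow> bool" where
  "keller_map F \<longleftrightarrow>
     (\<exists>P Q c. F = map_of_polys P Q \<and> c \<noteq> 0 \<and> jacobian_det P Q = [:[:c:]:])"

definition poly_automorphism :: "plane_map \<Rightarrow> bool" where
  "poly_automorphism F \<longleftrightarrow> poly_map F \<and> bij F \<and> poly_map (inv F)"

text \<open>
  Regular functions on \<open>\<G>\<^sub>m \<times> \<A>\<^sup>2\<close>, i.e. elements of \<open>\<complex>[t, 1/t, x, y]\<close>. The torus consists of
  the nonzero complex numbers; values at \<open>t = 0\<close> are irrelevant throughout.
\<close>

definition regular_Gm_plane :: "(complex \<Rightarrow> complex \<times> complex \<Rightarrow> complex) \<Rightarrow> bool" where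
  "regular_Gm_plane f \<longleftrightarrow>
     (\<exists>(K :: int set) p. finite K \<and>
        (\<forall>t x y. t \<noteq> 0 \<longrightarrow> f t (x, y) = (\<Sum>k\<in>K. t powi k * poly2 (p k) x y)))"

definition algebraic_action :: "(complex \<Rightarrow> plane_map) \<Rightarrow> bool" where
  "algebraic_action \<theta> \<longleftrightarrow>
     regular_Gm_plane (\<lambda>t z. fst (\<theta> t z)) \<and>
     regular_Gm_plane (\<lambda>t z. snd (\<theta> t z)) \<and>
     \<theta> 1 = id \<and>
     (\<forall>s t. s \<noteq> 0 \<longrightarrow> t \<noteq> 0 \<longrightarrow> \<theta> (s * t) = \<theta> s \<circ> \<theta> t)"

definition nontrivial_action :: "(complex \<Rightarrow> plane_map) \<Rightarrow> bool" where
  "nontrivial_action \<theta> \<longleftrightarrow> (\<exists>t. t \<noteq> 0 \<and> \<theta> t \<noteq> id)"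

definition diagonal_action :: "int \<Rightarrow> int \<Rightarrow> complex \<Rightarrow> plane_map" where
  "diagonal_action w1 w2 t = (\<lambda>(x, y). (t powi w1 * x, t powi w2 * y))"

definition elliptic :: "int \<Rightarrow> int \<Rightarrow> bool" where
  "elliptic w1 w2 \<longleftrightarrow> w1 \<noteq> 0 \<and> w2 \<noteq> 0 \<and> sgn w1 = sgn w2"

definition parabolic :: "int \<Rightarrow> int \<Rightarrow> bool" where
  "parabolic w1 w2 \<longleftrightarrow> w1 = 0 \<or> w2 = 0"

definition hyperbolic :: "int \<Rightarrow> int \<Rightarrow> bool" where
  "hyperbolic w1 w2 \<longleftrightarrow> w1 \<noteq> 0 \<and> w2 \<noteq> 0 \<and> sgn w1 \<noteq> sgn w2"

text \<open>
  Triangular with respect to the ordering \<open>x, y\<close>: the \<open>i\<close>-th component is a nonzero multiple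
  of the \<open>i\<close>-th variable plus a polynomial in the preceding variables.
\<close>

definition triangular_map :: "plane_map \<Rightarrow> bool" where
  "triangular_map F \<longleftrightarrow>
     (\<exists>a b c p. a \<noteq> 0 \<and> b \<noteq> 0 \<and> F = (\<lambda>(x, y). (a * x + c, b * y + poly p x)))"

definition affine_map :: "plane_map \<Rightarrow> bool" where
  "affine_map F \<longleftrightarrow>
     (\<exists>a b c d e f. F = (\<lambda>(x, y). (a * x + b * y + e, c * x + d * y + f)))"

definition linear_map :: "plane_map \<Rightarrow> bool" where
  "linear_map F \<longleftrightarrow> (\<exists>a b c d. F = (\<lambda>(x, y). (a * x + b * y, c * x + d * y)))"

end

theory Submission
  imports Defs
    "HOL-Computational_Algebra.Fundamental_Theorem_Algebra"
    "HOL-Computational_Algebra.Polynomial_Factorial"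
    "HOL-Computational_Algebra.Field_as_Ring"
begin

text \<open>
  Why it is true. Both actions can be made diagonal by automorphisms of the plane
  (\<open>torus_action_linearisable\<close>, a theorem of Gutwirth). After these coordinate changes \<open>G\<close> is a
  Keller map \<open>(P, Q)\<close> which intertwines two diagonal actions, so that \<open>P\<close> and \<open>Q\<close> are
  weighted homogeneous. Its linear part at the origin is invertible, which forces the weights of
  \<open>P\<close> and \<open>Q\<close> to be those of the two coordinates. If the weights have the same sign or one of
  them vanishes, there are so few monomials of these weights that \<open>(P, Q)\<close> is visibly linear,
  triangular or of the form \<open>(p x, q x * y)\<close>; if they have opposite signs, the terms of highest
  degree in \<open>y\<close> contribute a term to the Jacobian determinant that cannot cancel, unless
  \<open>(P, Q)\<close> is diagonal (\<open>equivariant_keller_automorphism\<close>). Hence \<open>G\<close> is an automorphism.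
  Once this is known, the target coordinates may be chosen to be the source coordinates
  transported by \<open>G\<close>: if \<open>\<phi>\<close> linearises \<open>\<theta>\<close> then \<open>\<psi> = \<phi> \<circ> inv G\<close> linearises \<open>\<eta>\<close>, with the
  same weights, and \<open>\<psi> \<circ> G \<circ> inv \<phi>\<close> is the identity, which has each of the required forms.

  The linearisation theorem is the substantial part. An action grades the polynomial ring
  \<open>A = \<complex>[x, y]\<close> by weights, and one has to find two homogeneous generators of \<open>A\<close>. They are
  obtained from a locally nilpotent derivation \<open>E\<close> that shifts the weights by a constant. Such
  derivations exist, for example the component of highest weight of \<open>dx\<close> (\<open>ex_hlnd\<close>). Choose
  one for which the images of \<open>X\<close> and \<open>Y\<close> have least degree; then no nonconstant homogeneous
  element of the kernel divides \<open>E\<close>. The kernel is closed under taking factors, so a nonconstant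
  homogeneous element \<open>f\<close> of least degree in it is prime. On the curve \<open>f = 0\<close> the derivation
  induced by \<open>E\<close> kills only constants (\<open>constant_mod_prime\<close>), because any three polynomials in
  two variables are algebraically dependent. This fact is used twice, as in Rentschler's theorem
  on locally nilpotent derivations of the plane: every \<open>g\<close> in the kernel is congruent to a
  constant modulo \<open>f\<close>, so by descent on the degree the kernel is \<open>\<complex>[f]\<close>; and if \<open>f\<close> divides
  \<open>E s\<close> then \<open>s\<close> can be divided by \<open>f\<close> after subtraction of a constant, so by descent on the
  degree of \<open>E s\<close> in \<open>f\<close> there is a homogeneous \<open>s\<close> for which \<open>E s\<close> is a nonzero constant.
  Then \<open>A = \<complex>[f, s]\<close>, by integration along \<open>s\<close>.
\<close>

section \<open>Polynomials in two variables\<close>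

type_synonym plane_poly = "complex poly poly"

definition cst :: "complex \<Rightarrow> plane_poly" where
  "cst z = [:[:z:]:]"

definition X :: plane_poly where
  "X = [:[:0, 1:]:]"

definition Y :: plane_poly where
  "Y = [:0, 1:]"

lemma poly2_simps [simp]:
  "poly2 0 x y = 0" "poly2 1 x y = 1"
  "poly2 (P + Q) x y = poly2 P x y + poly2 Q x y"
  "poly2 (P - Q) x y = poly2 P x y - poly2 Q x y"
  "poly2 (- P) x y = - poly2 P x y"
  "poly2 (P * Q) x y = poly2 P x y * poly2 Q x y"
  "poly2 (P ^ n) x y = poly2 P x y ^ n"
  "poly2 (cst z) x y = z"
  "poly2 X x y = x" "poly2 Y x y = y"
  by (simp_all add: poly2_def cst_def X_def Y_def)

lemma poly2_sum: "poly2 (sum f S) x y = (\<Sum>i\<in>S. poly2 (f i) x y)"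
  by (induction S rule: infinite_finite_induct) auto

lemma poly2_pCons [simp]: "poly2 (pCons p P) x y = poly p x + y * poly2 P x y"
  by (simp add: poly2_def)

lemma poly2_eqI:
  assumes "\<And>x y. poly2 P x y = poly2 Q x y"
  shows "P = Q"
proof -
  define R where "R = P - Q"
  have ev: "poly (poly R [:y:]) x = 0" for x y
    using assms[of x y] by (simp add: R_def poly2_def)
  have "poly R [:y:] = 0" for y
    using ev[of y] by (metis poly_all_0_iff_0)
  hence sub: "range (\<lambda>y. [:y:]) \<subseteq> {p. poly R p = 0}" by auto
  have "infinite (range (\<lambda>y :: complex. [:y:]))"
    using finite_imageD[of "\<lambda>y :: complex. [:y:]" UNIV] infinite_UNIV_char_0
    by (auto simp: inj_on_def)
  hence "R = 0" using sub poly_roots_finite[of R] finite_subset by blast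
  thus ?thesis by (simp add: R_def)
qed

lemma cst_simps [simp]:
  "cst 0 = 0" "cst 1 = 1" "cst (a + b) = cst a + cst b" "cst (a - b) = cst a - cst b"
  "cst (a * b) = cst a * cst b" "cst (- a) = - cst a" "cst a = cst b \<longleftrightarrow> a = b"
  by (auto simp: cst_def one_pCons)

lemma cst_eq_0_iff [simp]: "cst a = 0 \<longleftrightarrow> a = 0"
  by (simp add: cst_def)

lemma of_nat_eq_cst: "of_nat n = cst (of_nat n)"
  by (induction n) simp_all

lemma cst_inverse: "z \<noteq> 0 \<Longrightarrow> cst z * cst (1 / z) = 1" "z \<noteq> 0 \<Longrightarrow> cst (1 / z) * cst z = 1"
  by (simp_all add: cst_def one_pCons)

lemma cst_dvd [simp]: "z \<noteq> 0 \<Longrightarrow> cst z dvd P"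
  by (metis cst_inverse(1) dvd_mult_unit_iff dvd_refl dvd_triv_left dvd_trans one_dvd)

lemma dvd_cst_mult_iff [simp]: "z \<noteq> 0 \<Longrightarrow> F dvd cst z * P \<longleftrightarrow> F dvd P"
proof
  assume "z \<noteq> 0" "F dvd cst z * P"
  hence "F dvd cst (1 / z) * (cst z * P)" by (metis dvd_mult)
  moreover have "cst (1 / z) * (cst z * P) = P"
    using cst_inverse(2)[OF \<open>z \<noteq> 0\<close>] by (simp add: mult.assoc[symmetric] del: cst_simps)
  ultimately show "F dvd P" by simp
qed auto

lemma plane_poly_induct [case_names cst X Y add mult]:
  assumes "\<And>z. Pr (cst z)" "Pr X" "Pr Y"
    and add: "\<And>a b. Pr a \<Longrightarrow> Pr b \<Longrightarrow> Pr (a + b)"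
    and mult: "\<And>a b. Pr a \<Longrightarrow> Pr b \<Longrightarrow> Pr (a * b)"
  shows "Pr P"
proof -
  have const: "Pr [:p:]" for p
  proof (induction p)
    case 0
    show ?case using assms(1)[of 0] by simp
  next
    case (pCons a p)
    have "[:pCons a p:] = cst a + X * [:p:]"
      by (simp add: cst_def X_def)
    thus ?case using pCons assms(1) assms(2) add mult by metis
  qed
  show ?thesis
  proof (induction P)
    case 0
    show ?case using assms(1)[of 0] by simp
  next
    case (pCons a P)
    have "pCons a P = [:a:] + Y * P" by (simp add: Y_def)
    thus ?case using pCons const assms(3) add mult by metis
  qed
qed

text \<open>
  The exponent of the leading monomial, both entries added up. Unlike the total degree it is
  visibly additive on products, since it is made of two degrees and a leading coefficient.
\<close>

definition pdeg :: "plane_poly \<Rightarrow> nat" where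
  "pdeg P = degree P + degree (lead_coeff P)"

lemma pdeg_mult: "P \<noteq> 0 \<Longrightarrow> Q \<noteq> 0 \<Longrightarrow> pdeg (P * Q) = pdeg P + pdeg Q"
  unfolding pdeg_def lead_coeff_mult by (simp add: degree_mult_eq)

lemma pdeg_cst [simp]: "pdeg (cst z) = 0"
  by (simp add: pdeg_def cst_def)

lemma pdeg_0 [simp]: "pdeg 0 = 0"
  by (simp add: pdeg_def)

lemma pdeg_eq_0_iff: "pdeg P = 0 \<longleftrightarrow> P \<in> range cst"
proof
  assume "pdeg P = 0"
  hence "degree P = 0" "degree (lead_coeff P) = 0" by (auto simp: pdeg_def)
  thus "P \<in> range cst"
    by (metis cst_def degree_eq_zeroE lead_coeff_pCons(2) range_eqI)
qed auto

lemma pdeg_diff_cst: "pdeg (P - cst z) = pdeg P"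
proof (cases "degree P = 0")
  case True
  then obtain p where P: "P = [:p:]" by (metis degree_eq_zeroE)
  have "degree (p - [:z:]) = degree p"
  proof (cases "degree p = 0")
    case False
    thus ?thesis using degree_add_eq_left[of "- [:z:]" p] unfolding diff_conv_add_uminus by simp
  qed (auto elim: degree_eq_zeroE)
  thus ?thesis by (simp add: P pdeg_def cst_def)
next
  case False
  have "degree (P + - cst z) = degree P"
    using False by (intro degree_add_eq_left) (auto simp: cst_def)
  hence "degree (P - cst z) = degree P" by simp
  moreover have "coeff (P - cst z) (degree P) = coeff P (degree P)"
    using False by (auto simp: cst_def coeff_pCons split: nat.splits)
  ultimately show ?thesis by (simp add: pdeg_def)
qed

lemma unit_iff_cst: "P dvd 1 \<longleftrightarrow> P \<in> range cst - {0}"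
proof
  assume "P dvd 1"
  then obtain Q where "1 = P * Q" by (auto elim: dvdE)
  hence "P \<noteq> 0" "Q \<noteq> 0" by auto
  moreover from this have "pdeg P + pdeg Q = pdeg 1"
    using \<open>1 = P * Q\<close> pdeg_mult[of P Q] by simp
  moreover have "pdeg 1 = 0" using pdeg_cst[of 1] by simp
  ultimately show "P \<in> range cst - {0}" using pdeg_eq_0_iff by auto
qed auto

section \<open>Derivations\<close>

definition derivation :: "(plane_poly \<Rightarrow> plane_poly) \<Rightarrow> bool" where
  "derivation E \<longleftrightarrow> (\<forall>z. E (cst z) = 0) \<and> (\<forall>a b. E (a + b) = E a + E b) \<and>
     (\<forall>a b. E (a * b) = E a * b + a * E b)"

lemma derivationD:
  assumes "derivation E"
  shows "E (cst z) = 0" "E (a + b) = E a + E b" "E (a * b) = E a * b + a * E b"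
    "E 0 = 0" "E 1 = 0" "E (a - b) = E a - E b" "E (- a) = - E a"
    "E (cst z * a) = cst z * E a"
proof -
  show 1: "E (cst z) = 0" and 2: "E (a + b) = E a + E b" and 3: "E (a * b) = E a * b + a * E b" for a b z
    using assms by (auto simp: derivation_def)
  show "E 0 = 0" "E 1 = 0" using 1[of 0] 1[of 1] by auto
  show 4: "E (- a) = - E a" for a using 3[of "cst (-1)" a] 1[of "-1"] by simp
  show "E (a - b) = E a - E b" using 2[of a "-b"] 4[of b] by simp
  show "E (cst z * a) = cst z * E a" by (simp add: 1 3)
qed

lemma derivation_sum: "derivation E \<Longrightarrow> E (sum f S) = (\<Sum>i\<in>S. E (f i))"
  by (induction S rule: infinite_finite_induct) (auto simp: derivationD)

lemma derivation_eqI: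
  assumes "derivation D" "derivation E" "D X = E X" "D Y = E Y"
  shows "D = E"
proof
  fix a show "D a = E a"
    by (induction a rule: plane_poly_induct) (use assms in \<open>auto simp: derivationD\<close>)
qed

lemma dx_pCons: "dx (pCons p P) = pCons (pderiv p) (dx P)"
  by (auto simp: dx_def map_poly_pCons)

lemma derivation_dx: "derivation dx"
proof -
  have 0: "dx 0 = 0" by (simp add: dx_def)
  have add: "dx (a + b) = dx a + dx b" for a b
    by (intro poly_eqI) (simp add: dx_def coeff_map_poly pderiv_add)
  have smult: "dx (smult p a) = smult (pderiv p) a + smult p (dx a)" for p a
    by (intro poly_eqI) (simp add: dx_def coeff_map_poly pderiv_mult mult.commute)
  have "dx (a * b) = dx a * b + a * dx b" for a b
    by (induction a) (simp_all add: 0 add smult dx_pCons algebra_simps)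
  thus ?thesis using add by (auto simp: derivation_def cst_def dx_pCons 0)
qed

lemma derivation_dy: "derivation dy"
  unfolding derivation_def dy_def
  by (intro conjI allI) (simp_all add: cst_def pderiv_add pderiv_mult pderiv_pCons mult.commute[of "pderiv _"])

lemma dx_dy_simps [simp]: "dx X = 1" "dx Y = 0" "dy X = 0" "dy Y = 1"
  by (simp_all add: dx_def dy_def X_def Y_def map_poly_pCons pderiv_pCons one_pCons)

lemma derivation_combination:
  assumes "derivation D" "derivation E"
  shows "derivation (\<lambda>a. u * D a + v * E a)"
  using assms by (auto simp: derivation_def algebra_simps)

lemma derivation_expand:
  assumes "derivation E"
  shows "E a = dx a * E X + dy a * E Y"
proof -
  have "E = (\<lambda>a. E X * dx a + E Y * dy a)"
    by (rule derivation_eqI[OF assms derivation_combination[OF derivation_dx derivation_dy]]) simp_all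
  from fun_cong[OF this, of a] show ?thesis by (simp only: mult.commute)
qed

lemma dx_dy_zero_imp_cst:
  assumes "dx a = 0" "dy a = 0"
  shows "a \<in> range cst"
proof -
  have "degree a = 0" using assms(2) by (simp add: dy_def pderiv_eq_0_iff)
  then obtain p where a: "a = [:p:]" by (metis degree_eq_zeroE)
  hence "pderiv p = 0" using assms(1) by (simp add: dx_def map_poly_pCons)
  hence "degree p = 0" by (simp add: pderiv_eq_0_iff)
  thus ?thesis by (metis a cst_def degree_eq_zeroE range_eqI)
qed

lemma derivation_poly:
  assumes "derivation E"
  shows "E (poly H r) = poly (map_poly E H) r + poly (pderiv H) r * E r"
  by (induction H)
    (use assms in \<open>simp_all add: derivationD map_poly_pCons pderiv_pCons algebra_simps\<close>)

section \<open>Substitution\<close>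

definition ev :: "complex poly \<Rightarrow> plane_poly \<Rightarrow> plane_poly" where
  "ev q a = poly (map_poly cst q) a"

lemma ev_pCons [simp]: "ev (pCons c q) a = cst c + a * ev q a"
  by (simp add: ev_def map_poly_pCons)

lemma ev_0 [simp]: "ev 0 a = 0" by (simp add: ev_def)

lemma poly2_ev [simp]: "poly2 (ev q a) x y = poly q (poly2 a x y)"
  by (induction q) auto

lemma ev_mult: "ev (p * q) a = ev p a * ev q a"
  by (intro poly2_eqI) simp

definition subst :: "plane_poly \<Rightarrow> plane_poly \<Rightarrow> plane_poly \<Rightarrow> plane_poly" where
  "subst R f s = poly (map_poly (\<lambda>p. ev p f) R) s"

lemma subst_pCons [simp]: "subst (pCons p R) f s = ev p f + s * subst R f s"
  by (simp add: subst_def map_poly_pCons)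


lemma poly2_subst [simp]: "poly2 (subst R f s) x y = poly2 R (poly2 f x y) (poly2 s x y)"
  by (induction R) (auto simp: subst_def[of 0])

lemma subst_simps [simp]:
  "subst (P + Q) f s = subst P f s + subst Q f s"
  "subst (P - Q) f s = subst P f s - subst Q f s"
  "subst (P * Q) f s = subst P f s * subst Q f s"
  "subst 0 f s = 0" "subst 1 f s = 1" "subst (cst z) f s = cst z" "subst X f s = f" "subst Y f s = s"
  by (rule poly2_eqI; simp)+

lemma derivation_ev:
  assumes "derivation E"
  shows "E (ev q a) = ev (pderiv q) a * E a"
proof (induction q)
  case (pCons c q)
  have "ev (p + q) a = ev p a + ev q a" for p q by (intro poly2_eqI) simp
  with pCons show ?case
    using assms by (simp add: derivationD pderiv_pCons algebra_simps)
qed (use assms in \<open>simp add: derivationD\<close>)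

lemma derivation_subst:
  assumes "derivation E"
  shows "E (subst R f s) = subst (dx R) f s * E f + subst (dy R) f s * E s"
  by (induction R rule: plane_poly_induct)
    (use assms in \<open>simp_all add: derivationD derivationD[OF derivation_dx]
       derivationD[OF derivation_dy] algebra_simps\<close>)

lemma jacobian_subst:
  "jacobian_det (subst P f s) (subst Q f s) = subst (jacobian_det P Q) f s * jacobian_det f s"
  by (simp add: jacobian_det_def derivation_subst derivation_dx derivation_dy algebra_simps)

section \<open>Algebraic dependence\<close>

definition bidegree_le :: "nat \<Rightarrow> plane_poly set" where
  "bidegree_le n = {P. degree P \<le> n \<and> (\<forall>k. degree (coeff P k) \<le> n)}"

lemma bidegree_le_mult: "a \<in> bidegree_le m \<Longrightarrow> b \<in> bidegree_le n \<Longrightarrow> a * b \<in> bidegree_le (m + n)"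
proof -
  assume a: "a \<in> bidegree_le m" and b: "b \<in> bidegree_le n"
  have "degree (a * b) \<le> m + n"
    using a b degree_mult_le[of a b] by (auto simp: bidegree_le_def)
  moreover have "degree (coeff (a * b) k) \<le> m + n" for k
    unfolding coeff_mult
  proof (rule degree_sum_le)
    fix i assume "i \<in> {..k}"
    show "degree (coeff a i * coeff b (k - i)) \<le> m + n"
      using a b by (intro order.trans[OF degree_mult_le] add_mono) (auto simp: bidegree_le_def)
  qed auto
  ultimately show ?thesis by (auto simp: bidegree_le_def)
qed

lemma bidegree_le_power: "a \<in> bidegree_le m \<Longrightarrow> a ^ i \<in> bidegree_le (i * m)"
  by (induction i) (auto intro: bidegree_le_mult simp: bidegree_le_def[of 0] one_pCons coeff_pCons split: nat.splits)

lemma bidegree_le_mono: "m \<le> n \<Longrightarrow> bidegree_le m \<subseteq> bidegree_le n"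
  by (auto simp: bidegree_le_def intro: order.trans)

lemma ex_bidegree_le: "\<exists>n. a \<in> bidegree_le n"
proof -
  define n where "n = Max (insert (degree a) ((\<lambda>k. degree (coeff a k)) ` {..degree a}))"
  have "degree (coeff a k) \<le> n" for k
  proof (cases "k \<le> degree a")
    case True
    thus ?thesis unfolding n_def by (intro Max_ge) simp_all
  qed (simp add: coeff_eq_0)
  moreover have "degree a \<le> n" unfolding n_def by (intro Max_ge) simp_all
  ultimately show ?thesis by (auto simp: bidegree_le_def)
qed

lemma poly_eq_sum_upto:
  fixes x :: "'a :: comm_ring_1"
  assumes "degree p \<le> n"
  shows "poly p x = (\<Sum>i\<le>n. coeff p i * x ^ i)"
  unfolding poly_altdef
  by (rule sum.mono_neutral_left) (use assms in \<open>auto simp: coeff_eq_0\<close>)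

lemma bidegree_le_expand:
  assumes "P \<in> bidegree_le n"
  shows "P = (\<Sum>(i, j)\<in>{..n} \<times> {..n}. cst (coeff (coeff P j) i) * (X ^ i * Y ^ j))"
proof (rule poly2_eqI)
  fix x y
  have "poly2 P x y = poly (\<Sum>j\<le>n. coeff P j * [:y:] ^ j) x"
    using assms by (simp add: poly2_def bidegree_le_def poly_eq_sum_upto[where n = n])
  also have "\<dots> = (\<Sum>j\<le>n. (\<Sum>i\<le>n. coeff (coeff P j) i * x ^ i) * y ^ j)"
    using assms by (simp add: poly_sum bidegree_le_def poly_eq_sum_upto[where n = n])
  also have "\<dots> = (\<Sum>(i, j)\<in>{..n} \<times> {..n}. coeff (coeff P j) i * (x ^ i * y ^ j))"
    by (subst sum.cartesian_product[symmetric], subst sum.swap)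
      (simp add: sum_distrib_right mult.assoc)
  finally show "poly2 P x y =
      poly2 (\<Sum>(i, j)\<in>{..n} \<times> {..n}. cst (coeff (coeff P j) i) * (X ^ i * Y ^ j)) x y"
    by (simp add: poly2_sum case_prod_unfold)
qed

lemma linear_relation_of_bounded_bidegree:
  fixes v :: "'i \<Rightarrow> plane_poly"
  assumes "finite I" "v ` I \<subseteq> bidegree_le n" "(n + 1)\<^sup>2 < card I"
  shows "\<exists>c. (\<exists>i\<in>I. c i \<noteq> 0) \<and> (\<Sum>i\<in>I. cst (c i) * v i) = 0"
proof (cases "inj_on v I")
  case False
  then obtain i j where ij: "i \<in> I" "j \<in> I" "i \<noteq> j" "v i = v j" by (auto simp: inj_on_def)
  define c :: "'i \<Rightarrow> complex" where "c k = (if k = i then 1 else if k = j then -1 else 0)" for k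
  have "(\<Sum>k\<in>I. cst (c k) * v k) = (\<Sum>k\<in>{i, j}. cst (c k) * v k)"
    by (rule sum.mono_neutral_right) (use ij assms in \<open>auto simp: c_def\<close>)
  also have "\<dots> = 0" using ij by (auto simp: c_def)
  finally show ?thesis using ij by (intro exI[of _ c]) (auto simp: c_def)
next
  case True
  interpret V: vector_space "\<lambda>c (P :: plane_poly). cst c * P"
    by unfold_locales (auto simp: algebra_simps)
  define T where "T = (\<lambda>(i, j). X ^ i * Y ^ j) ` ({..n} \<times> {..n})"
  have T: "finite T" by (simp add: T_def)
  have "card T \<le> card ({..n} \<times> {..n})" unfolding T_def by (rule card_image_le) auto
  hence "card T < card (v ` I)"
    using assms True by (simp add: card_image card_cartesian_product power2_eq_square)
  moreover have "v ` I \<subseteq> V.span T"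
  proof
    fix P assume "P \<in> v ` I"
    hence "P \<in> bidegree_le n" using assms by blast
    have "(\<Sum>(i, j)\<in>{..n} \<times> {..n}. cst (coeff (coeff P j) i) * (X ^ i * Y ^ j)) \<in> V.span T"
      unfolding case_prod_unfold
      by (intro V.span_sum V.span_scale V.span_base) (auto simp: T_def)
    thus "P \<in> V.span T" using bidegree_le_expand[OF \<open>P \<in> bidegree_le n\<close>] by simp
  qed
  ultimately have "V.dependent (v ` I)"
    using V.independent_span_bound[OF T] by fastforce
  then obtain u where u: "\<exists>w\<in>v ` I. u w \<noteq> 0" "(\<Sum>w\<in>v ` I. cst (u w) * w) = 0"
    using V.dependent_finite[of "v ` I"] assms by auto
  from u(2) have "(\<Sum>i\<in>I. cst (u (v i)) * v i) = 0"
    by (subst (asm) sum.reindex[OF True]) simp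
  with u(1) show ?thesis by (intro exI[of _ "u \<circ> v"]) auto
qed

text \<open>
  There are \<open>(N + 1)\<^sup>3\<close> monomials in the three polynomials with exponents up to \<open>N\<close>, and these lie
  in a space whose dimension grows only like \<open>N\<^sup>2\<close>.
\<close>

lemma three_polys_dependent:
  obtains N c where "\<exists>i\<le>N. \<exists>j\<le>N. \<exists>k\<le>N. c i j k \<noteq> 0"
    "(\<Sum>i\<le>N. \<Sum>j\<le>N. \<Sum>k\<le>N. cst (c i j k) * (P ^ i * a ^ j * r ^ k)) = 0"
proof -
  obtain m1 m2 m3 where "P \<in> bidegree_le m1" "a \<in> bidegree_le m2" "r \<in> bidegree_le m3" using ex_bidegree_le by metis
  hence m: "P \<in> bidegree_le (m1 + m2 + m3)" "a \<in> bidegree_le (m1 + m2 + m3)" "r \<in> bidegree_le (m1 + m2 + m3)"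
    using bidegree_le_mono[of _ "m1 + m2 + m3"] by (meson le_add1 le_add2 subsetD order.trans)+
  define m where "m = m1 + m2 + m3"
  define M where "M = 3 * m"
  \<comment> \<open>Large enough that \<open>(M N + 1)\<^sup>2 \<le> ((M + 1) (N + 1))\<^sup>2 < (N + 1)\<^sup>3\<close>.\<close>
  define N where "N = (M + 1)\<^sup>2"
  define I where "I = {..N} \<times> {..N} \<times> {..N}"
  define v where "v = (\<lambda>(i, j, k). P ^ i * a ^ j * r ^ k)"
  have "v ` I \<subseteq> bidegree_le (M * N)"
  proof
    fix Q assume "Q \<in> v ` I"
    then obtain i j k where ijk: "i \<le> N" "j \<le> N" "k \<le> N" and Q: "Q = P ^ i * a ^ j * r ^ k"
      by (auto simp: v_def I_def)
    have "Q \<in> bidegree_le (i * m + j * m + k * m)"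
      unfolding Q using m by (intro bidegree_le_mult bidegree_le_power) (auto simp: m_def)
    moreover have "i * m + j * m + k * m \<le> M * N"
    proof -
      have "(i + j + k) * m \<le> (3 * N) * m" using ijk by (intro mult_le_mono1) simp
      thus ?thesis by (simp add: M_def algebra_simps)
    qed
    ultimately show "Q \<in> bidegree_le (M * N)" using bidegree_le_mono by blast
  qed
  moreover have "(M * N + 1)\<^sup>2 < card I"
  proof -
    have "(M * N + 1)\<^sup>2 \<le> ((M + 1) * (N + 1))\<^sup>2" by (intro power_mono) (simp_all add: algebra_simps)
    also have "\<dots> = N * (N + 1)\<^sup>2" by (simp only: power_mult_distrib N_def[symmetric])
    also have "\<dots> < (N + 1) * (N + 1)\<^sup>2" by simp
    also have "\<dots> = card I" by (simp add: I_def card_cartesian_product power2_eq_square)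
    finally show ?thesis .
  qed
  ultimately obtain c where c: "\<exists>p\<in>I. c p \<noteq> 0" "(\<Sum>p\<in>I. cst (c p) * v p) = 0"
    using linear_relation_of_bounded_bidegree[of I v "M * N"] by (auto simp: I_def)
  from c(2) have "(\<Sum>i\<le>N. \<Sum>j\<le>N. \<Sum>k\<le>N. cst (c (i, j, k)) * (P ^ i * a ^ j * r ^ k)) = 0"
    by (simp add: I_def v_def sum.cartesian_product case_prod_unfold)
  moreover have "\<exists>i\<le>N. \<exists>j\<le>N. \<exists>k\<le>N. c (i, j, k) \<noteq> 0" using c(1) by (auto simp: I_def)
  ultimately show ?thesis using that[of N "\<lambda>i j k. c (i, j, k)"] by simp
qed

section \<open>Derivations modulo a prime\<close>

lemma dvd_poly: "(\<And>k. F dvd coeff G k) \<Longrightarrow> F dvd poly G (r :: plane_poly)"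
  unfolding poly_altdef by (intro dvd_sum) auto

text \<open>
  If \<open>E\<close> kills the coefficients of \<open>H\<close> modulo \<open>F\<close>, it maps the value \<open>H r\<close> to \<open>H' r * E r\<close>
  modulo \<open>F\<close>, so the claim for \<open>H\<close> reduces to the claim for its derivative. The two conditions on
  \<open>F\<close> are satisfied both by suitable prime elements and by \<open>0\<close>; for \<open>F = 0\<close> the lemma says that
  \<open>r\<close> is transcendental over the kernel of \<open>E\<close>.
\<close>

lemma coeff_dvd_if_poly_dvd:
  assumes E: "derivation E" and F: "\<And>a b. F dvd a * b \<Longrightarrow> F dvd a \<or> F dvd b" "F dvd E F"
    and r: "\<not> F dvd E r"
  shows "(\<And>k. F dvd E (coeff H k)) \<Longrightarrow> F dvd poly H r \<Longrightarrow> F dvd coeff H k"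
proof (induction "degree H" arbitrary: H k rule: less_induct)
  case less
  show ?case
  proof (cases "degree H = 0")
    case True
    then obtain h where "H = [:h:]" by (metis degree_eq_zeroE)
    thus ?thesis using less.prems by (cases k) auto
  next
    case False
    obtain u where u: "poly H r = F * u" using less.prems(2) by (auto elim: dvdE)
    have "F dvd E (poly H r)" using F(2) by (simp add: u derivationD[OF E])
    moreover have "F dvd poly (map_poly E H) r"
      by (rule dvd_poly) (use less.prems E in \<open>simp add: coeff_map_poly derivationD\<close>)
    ultimately have "F dvd poly (pderiv H) r * E r"
      using dvd_add_right_iff by (metis derivation_poly[OF E])
    hence "F dvd poly (pderiv H) r" using F(1) r by blast
    moreover have "F dvd E (coeff (pderiv H) i)" for i
      using less.prems(1) derivationD[OF E] by (simp add: coeff_pderiv of_nat_eq_cst del: of_nat_Suc)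
    moreover have "degree (pderiv H) < degree H" using False by (simp add: degree_pderiv)
    ultimately have "F dvd coeff (pderiv H) i" for i using less.hyps by blast
    hence pos: "F dvd coeff H (Suc i)" for i
      by (auto simp: coeff_pderiv of_nat_eq_cst simp del: of_nat_Suc)
    obtain h H' where H: "H = pCons h H'" by (cases H)
    have "F dvd poly H' r" using pos H by (intro dvd_poly) (metis coeff_pCons_Suc)
    hence "F dvd h" using less.prems(2) H by (simp add: dvd_add_left_iff)
    thus ?thesis using pos H by (cases k) auto
  qed
qed

lemma kernel_coeffs_independent:
  assumes E: "derivation E" and r: "E r \<noteq> 0"
    and H: "\<And>k. E (coeff H k) = 0" "poly H r = 0"
  shows "H = 0"
proof (rule poly_eqI)
  fix k
  have "0 dvd coeff H k"
    by (rule coeff_dvd_if_poly_dvd[OF E]) (use r H E in \<open>auto simp: derivationD\<close>)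
  thus "coeff H k = coeff 0 k" by simp
qed

lemma ev_eq_0_imp_eq_0:
  assumes "a \<notin> range cst" "ev q a = 0"
  shows "q = 0"
proof -
  obtain E where E: "derivation E" "E a \<noteq> 0"
    using assms dx_dy_zero_imp_cst derivation_dx derivation_dy by metis
  have "map_poly cst q = 0"
    by (rule kernel_coeffs_independent[OF E])
      (use assms in \<open>simp_all add: coeff_map_poly derivationD[OF E(1)] ev_def\<close>)
  hence "cst (coeff q k) = 0" for k by (metis coeff_map_poly cst_simps(1) coeff_0)
  thus ?thesis by (intro poly_eqI) simp
qed

lemma prime_dvd_ev:
  assumes "prime_elem F" "F dvd ev q a" "q \<noteq> 0"
  shows "\<exists>\<mu>. F dvd a - cst \<mu>"
  using assms(2,3)
proof (induction "degree q" arbitrary: q rule: less_induct)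
  case less
  show ?case
  proof (cases "degree q = 0")
    case True
    then obtain c where "q = [:c:]" by (metis degree_eq_zeroE)
    hence "F dvd cst c" "c \<noteq> 0" using less.prems by auto
    hence "F dvd 1" using cst_dvd dvd_trans by blast
    thus ?thesis using assms(1) by (simp add: prime_elem_def)
  next
    case False
    then obtain \<mu> where "poly q \<mu> = 0"
      using fundamental_theorem_of_algebra constant_degree by metis
    then obtain q' where q': "q = [:- \<mu>, 1:] * q'" by (auto simp: poly_eq_0_iff_dvd elim: dvdE)
    have "ev q a = (a - cst \<mu>) * ev q' a"
      by (simp add: q' ev_mult del: mult_pCons_left)
    hence "F dvd a - cst \<mu> \<or> F dvd ev q' a"
      using less.prems assms(1) prime_elem_dvd_mult_iff by metis
    moreover have "degree q' < degree q" "q' \<noteq> 0"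
      using less.prems q' by (auto simp: degree_mult_eq simp del: mult_pCons_left)
    ultimately show ?thesis using less.hyps by blast
  qed
qed

text \<open>
  Reduce modulo \<open>F\<close>: the curve \<open>F = 0\<close> has one-dimensional function field, on which \<open>E\<close> induces
  a nonzero derivation, so the elements it kills are algebraic over \<open>\<complex>\<close>, hence constant.
  Concretely, one divides an algebraic relation between \<open>F\<close>, \<open>a\<close> and \<open>r\<close> by a power of \<open>F\<close>, so
  that a nontrivial relation between \<open>a\<close> and \<open>r\<close> modulo \<open>F\<close> remains; applying \<open>E\<close> repeatedly
  separates the powers of \<open>r\<close> and leaves a polynomial in \<open>a\<close>, one of whose linear factors must
  be divisible by \<open>F\<close>.
\<close>

lemma constant_mod_prime:
  assumes E: "derivation E" and F: "prime_elem F" "F dvd E F"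
    and r: "\<not> F dvd E r" and a: "F dvd E a"
  shows "\<exists>\<mu>. F dvd a - cst \<mu>"
proof -
  obtain N c where nz: "\<exists>i\<le>N. \<exists>j\<le>N. \<exists>k\<le>N. c i j k \<noteq> 0"
    and rel: "(\<Sum>i\<le>N. \<Sum>j\<le>N. \<Sum>k\<le>N. cst (c i j k) * (F ^ i * a ^ j * r ^ k)) = 0"
    by (rule three_polys_dependent)
  define q where "q i k = (\<Sum>j\<le>N. monom (c i j k) j)" for i k
  define H where "H i = (\<Sum>k\<le>N. monom (ev (q i k) a) k)" for i
  have ev_q: "ev (q i k) a = (\<Sum>j\<le>N. cst (c i j k) * a ^ j)" for i k
    by (rule poly2_eqI) (simp add: q_def poly2_sum poly_sum poly_monom)
  have H: "F ^ i * poly (H i) r = (\<Sum>j\<le>N. \<Sum>k\<le>N. cst (c i j k) * (F ^ i * a ^ j * r ^ k))" for i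
    unfolding H_def ev_q
    by (subst sum.swap)
      (simp add: poly_sum poly_monom sum_distrib_left sum_distrib_right mult_ac)
  define i0 where "i0 = (LEAST i. \<exists>j\<le>N. \<exists>k\<le>N. c i j k \<noteq> 0)"
  have i0: "\<exists>j\<le>N. \<exists>k\<le>N. c i0 j k \<noteq> 0" unfolding i0_def by (rule LeastI_ex) (use nz in blast)
  have "i0 \<le> N"
  proof -
    obtain i where "i \<le> N" "\<exists>j\<le>N. \<exists>k\<le>N. c i j k \<noteq> 0" using nz by blast
    thus ?thesis
      unfolding i0_def using Least_le[of "\<lambda>i. \<exists>j\<le>N. \<exists>k\<le>N. c i j k \<noteq> 0" i] by simp
  qed
  have "poly (H i) r = 0" if "i < i0" for i
  proof -
    have "c i j k = 0" if "j \<le> N" "k \<le> N" for j k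
      using not_less_Least[OF \<open>i < i0\<close>[unfolded i0_def]] that by auto
    thus ?thesis by (simp add: H_def ev_q)
  qed
  hence higher: "F ^ Suc i0 dvd F ^ i * poly (H i) r" if "i \<noteq> i0" for i
    using that by (cases "i < i0") (auto intro!: dvd_mult2 le_imp_power_dvd simp del: power_Suc)
  define S where "S = (\<Sum>i\<in>{..N} - {i0}. F ^ i * poly (H i) r)"
  have "F ^ Suc i0 dvd S"
    unfolding S_def by (intro dvd_sum higher) auto
  moreover have "F ^ i0 * poly (H i0) r + S = 0"
    using rel \<open>i0 \<le> N\<close> unfolding H[symmetric] S_def by (simp add: sum.remove[of _ i0])
  hence "F ^ i0 * poly (H i0) r = - S" by (simp only: add_eq_0_iff2)
  ultimately have "F ^ Suc i0 dvd F ^ i0 * poly (H i0) r"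
    by (simp only: dvd_minus_iff)
  hence "F dvd poly (H i0) r"
    using F(1) by (simp add: power_Suc2 prime_elem_def del: power_Suc)
  have coeff_H: "coeff (H i) k = (if k \<le> N then ev (q i k) a else 0)" for i k
    by (simp add: H_def coeff_sum)
  have "F dvd coeff (H i0) k" for k
  proof (rule coeff_dvd_if_poly_dvd[OF E _ F(2) r])
    show "F dvd E (coeff (H i0) k)" for k
      using a derivationD[OF E] by (simp add: coeff_H derivation_ev[OF E])
  qed (use F(1) \<open>F dvd poly (H i0) r\<close> in \<open>auto simp: prime_elem_dvd_mult_iff\<close>)
  moreover obtain j k where jk: "j \<le> N" "k \<le> N" "c i0 j k \<noteq> 0" using i0 by blast
  ultimately have "F dvd ev (q i0 k) a" by (metis coeff_H)
  moreover have "coeff (q i0 k) j \<noteq> 0" using jk by (simp add: q_def coeff_sum)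
  hence "q i0 k \<noteq> 0" by auto
  ultimately show ?thesis using prime_dvd_ev F(1) by blast
qed

section \<open>Locally nilpotent derivations\<close>

definition locally_nilpotent :: "(plane_poly \<Rightarrow> plane_poly) \<Rightarrow> bool" where
  "locally_nilpotent E \<longleftrightarrow> (\<forall>a. \<exists>n. (E ^^ n) a = 0)"

lemma funpow_derivation_0: "derivation E \<Longrightarrow> (E ^^ n) 0 = 0"
  by (induction n) (auto simp: derivationD)

lemma funpow_derivation_add: "derivation E \<Longrightarrow> (E ^^ n) (a + b) = (E ^^ n) a + (E ^^ n) b"
  by (induction n) (auto simp: derivationD)

lemma funpow_derivation_ge: "derivation E \<Longrightarrow> (E ^^ n) a = 0 \<Longrightarrow> n \<le> m \<Longrightarrow> (E ^^ m) a = 0"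
  by (metis funpow_add comp_apply le_add_diff_inverse2 funpow_derivation_0)

text \<open>The surviving term of the Leibniz rule for iterates; \<open>c\<close> is a binomial coefficient.\<close>

lemma leibniz_top:
  assumes E: "derivation E"
  shows "(E ^^ Suc m) a = 0 \<Longrightarrow> (E ^^ Suc n) b = 0 \<Longrightarrow>
    \<exists>c > 0. (E ^^ (m + n)) (a * b) = of_nat c * ((E ^^ m) a * (E ^^ n) b)"
proof (induction "m + n" arbitrary: m n a b)
  case 0
  thus ?case by (intro exI[of _ 1]) auto
next
  case (Suc l)
  have split: "(E ^^ (m + n)) (a * b) = (E ^^ l) (E a * b) + (E ^^ l) (a * E b)"
    unfolding Suc.hyps(2)[symmetric] funpow_Suc_right comp_apply derivationD(3)[OF E]
    by (rule funpow_derivation_add[OF E])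
  have 1: "(E ^^ l) (E a * b) = 0 \<and> m = 0 \<or>
      (\<exists>c>0. (E ^^ l) (E a * b) = of_nat c * ((E ^^ m) a * (E ^^ n) b))"
  proof (cases m)
    case 0
    thus ?thesis using Suc.prems by (simp add: funpow_derivation_0[OF E])
  next
    case (Suc m')
    have "\<exists>c>0. (E ^^ (m' + n)) (E a * b) = of_nat c * ((E ^^ m') (E a) * (E ^^ n) b)"
      using Suc.prems Suc \<open>Suc l = m + n\<close> by (intro Suc.hyps(1)) (auto simp: funpow_swap1)
    thus ?thesis using Suc \<open>Suc l = m + n\<close> by (simp add: funpow_swap1)
  qed
  have 2: "(E ^^ l) (a * E b) = 0 \<and> n = 0 \<or>
      (\<exists>c>0. (E ^^ l) (a * E b) = of_nat c * ((E ^^ m) a * (E ^^ n) b))"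
  proof (cases n)
    case 0
    thus ?thesis using Suc.prems by (simp add: funpow_derivation_0[OF E])
  next
    case (Suc n')
    have "\<exists>c>0. (E ^^ (m + n')) (a * E b) = of_nat c * ((E ^^ m) a * (E ^^ n') (E b))"
      using Suc.prems Suc \<open>Suc l = m + n\<close> by (intro Suc.hyps(1)) (auto simp: funpow_swap1)
    thus ?thesis using Suc \<open>Suc l = m + n\<close> by (simp add: funpow_swap1)
  qed
  from 1 2 show ?case
  proof (elim disjE exE conjE)
    fix c d :: nat
    assume "c > 0" "(E ^^ l) (E a * b) = of_nat c * ((E ^^ m) a * (E ^^ n) b)"
      "d > 0" "(E ^^ l) (a * E b) = of_nat d * ((E ^^ m) a * (E ^^ n) b)"
    thus ?thesis by (intro exI[of _ "c + d"]) (simp add: split algebra_simps)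
  qed (use Suc.hyps(2) split in auto)
qed

lemma nilpotency_order:
  assumes "locally_nilpotent E" "a \<noteq> 0"
  obtains m where "(E ^^ m) a \<noteq> 0" "(E ^^ Suc m) a = 0"
proof -
  define n where "n = (LEAST n. (E ^^ n) a = 0)"
  have n: "(E ^^ n) a = 0" unfolding n_def
    by (rule LeastI_ex) (use assms in \<open>auto simp: locally_nilpotent_def\<close>)
  then obtain m where m: "n = Suc m" using assms by (cases n) auto
  have "(E ^^ m) a \<noteq> 0" using not_less_Least[of m "\<lambda>n. (E ^^ n) a = 0"] m by (simp add: n_def)
  thus ?thesis using that n m by blast
qed

text \<open>
  By the Leibniz rule the nilpotency orders of the factors add up to that of the product, and
  the elements of the kernel are those of order zero.
\<close>

lemma kernel_factorially_closed:
  assumes E: "derivation E" "locally_nilpotent E" and ab: "E (a * b) = 0" "a * b \<noteq> 0"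
  shows "E a = 0" "E b = 0"
proof -
  obtain m where m: "(E ^^ m) a \<noteq> 0" "(E ^^ Suc m) a = 0"
    using nilpotency_order[OF E(2), of a] ab by auto
  obtain n where n: "(E ^^ n) b \<noteq> 0" "(E ^^ Suc n) b = 0"
    using nilpotency_order[OF E(2), of b] ab by auto
  obtain c where "c > 0" "(E ^^ (m + n)) (a * b) = of_nat c * ((E ^^ m) a * (E ^^ n) b)"
    using leibniz_top[OF E(1) m(2) n(2)] by blast
  hence "(E ^^ (m + n)) (a * b) \<noteq> 0" using m n by simp
  hence "m + n = 0" using funpow_derivation_ge[OF E(1), of 1 "a * b" "m + n"] ab(1) by fastforce
  thus "E a = 0" "E b = 0" using m n by auto
qed

lemma local_slice:
  assumes "locally_nilpotent E" "E a \<noteq> 0" "derivation E"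
  shows "\<exists>r. E r \<noteq> 0 \<and> E (E r) = 0"
proof -
  have "a \<noteq> 0" using assms by (auto simp: derivationD)
  then obtain m where m: "(E ^^ m) a \<noteq> 0" "(E ^^ Suc m) a = 0"
    using nilpotency_order assms(1) by metis
  moreover have "m \<noteq> 0" using m assms by (cases m) auto
  then obtain k where "m = Suc k" by (cases m) auto
  ultimately show ?thesis by (intro exI[of _ "(E ^^ k) a"]) auto
qed

lemma antiderivative:
  assumes E: "derivation E" and H: "\<And>k. E (coeff H k) = 0"
  shows "\<exists>G. pderiv G = H \<and> (\<forall>k. E (coeff G k) = 0)"
proof -
  define G where "G = (\<Sum>i\<le>degree H. monom (cst (1 / of_nat (Suc i)) * coeff H i) (Suc i))"
  have "coeff (pderiv G) k = coeff H k" for k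
  proof -
    have "coeff (pderiv G) k = of_nat (Suc k) *
        (\<Sum>i\<le>degree H. if i = k then cst (1 / of_nat (Suc i)) * coeff H i else 0)"
      unfolding coeff_pderiv G_def coeff_sum by (auto intro!: sum.cong)
    also have "\<dots> = of_nat (Suc k) * (cst (1 / of_nat (Suc k)) * coeff H k)"
      by (auto simp: coeff_eq_0)
    also have "\<dots> = coeff H k"
      unfolding of_nat_eq_cst mult.assoc[symmetric] by (subst cst_inverse) (auto simp del: of_nat_Suc)
    finally show ?thesis .
  qed
  moreover have "E (coeff G k) = 0" for k
    unfolding G_def coeff_sum
    by (auto simp: derivation_sum[OF E] derivationD[OF E] H intro!: sum.neutral
        simp del: cst_simps)
  ultimately show ?thesis by (intro exI[of _ G]) (auto intro: poly_eqI)
qed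

text \<open>
  On polynomials in \<open>r\<close> over its kernel, \<open>E\<close> is a multiple of the derivative with respect to \<open>r\<close>.
  So one recovers \<open>a\<close> from \<open>E a\<close> by integration, up to an element of the kernel.
\<close>

lemma slice_expansion:
  assumes E: "derivation E" and r: "E r = cst e" "e \<noteq> 0"
  shows "(E ^^ n) a = 0 \<Longrightarrow> \<exists>H. (\<forall>k. E (coeff H k) = 0) \<and> a = poly H r"
proof (induction n arbitrary: a)
  case 0
  thus ?case by (intro exI[of _ 0]) (auto simp: derivationD[OF E])
next
  case (Suc n)
  hence "(E ^^ n) (E a) = 0" by (simp add: funpow_swap1)
  then obtain H where H: "\<And>k. E (coeff H k) = 0" "E a = poly H r" using Suc.IH by blast
  obtain G where G: "pderiv G = smult (cst (1 / e)) H" "\<And>k. E (coeff G k) = 0"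
    using antiderivative[OF E, of "smult (cst (1 / e)) H"] H by (auto simp: derivationD[OF E])
  have "map_poly E G = 0" using G(2) by (intro poly_eqI) (simp add: coeff_map_poly derivationD[OF E])
  hence "E (poly G r) = (cst (1 / e) * cst e) * poly H r"
    by (simp only: derivation_poly[OF E] G r) (simp add: mult_ac)
  hence "E (a - poly G r) = 0" using cst_inverse(2)[OF r(2)] by (simp add: derivationD[OF E] H)
  hence "E (coeff (G + [:a - poly G r:]) k) = 0" for k
    using G(2) by (cases k) (auto simp: derivationD[OF E])
  thus ?case by (intro exI[of _ "G + [:a - poly G r:]"]) auto
qed

lemma map_poly_exists:
  assumes "h 0 = 0" "\<And>k. coeff H k \<in> range h"
  shows "\<exists>q. H = map_poly h q"
  using assms(2)
proof (induction H)
  case (pCons a H)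
  have "coeff H k \<in> range h" for k using pCons.prems[of "Suc k"] by simp
  then obtain q where "H = map_poly h q" using pCons.IH by blast
  moreover obtain c where "a = h c" using pCons.prems[of 0] by auto
  ultimately show ?case using assms(1) by (intro exI[of _ "pCons c q"]) (simp add: map_poly_pCons)
qed (auto intro: exI[of _ 0])

text \<open>
  If the kernel consisted of constants only, a local slice would be a slice, and the polynomial
  ring in two variables would be generated by a single element.
\<close>

lemma kernel_nonconstant:
  assumes E: "derivation E" "locally_nilpotent E" "E a \<noteq> 0"
  shows "\<exists>f. E f = 0 \<and> f \<notin> range cst"
proof (rule ccontr)
  assume "\<not> ?thesis"
  hence const: "f \<in> range cst" if "E f = 0" for f using that by blast
  obtain r where r: "E r \<noteq> 0" "E (E r) = 0" using local_slice E by blast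
  then obtain e where e: "E r = cst e" "e \<noteq> 0" using const by fastforce
  have gen: "\<exists>q. b = ev q r" for b
  proof -
    obtain n where "(E ^^ n) b = 0" using E(2) by (auto simp: locally_nilpotent_def)
    then obtain H where "\<And>k. E (coeff H k) = 0" "b = poly H r"
      using slice_expansion[OF E(1) e] by blast
    thus ?thesis using map_poly_exists[of cst H] const by (auto simp: ev_def)
  qed
  obtain p q where pq: "X = ev p r" "Y = ev q r" using gen by metis
  have "1 = ev (pderiv p) r * dx r" "0 = ev (pderiv p) r * dy r"
    using arg_cong[OF pq(1), of dx] arg_cong[OF pq(1), of dy]
    by (simp_all add: derivation_ev derivation_dx derivation_dy)
  hence "dy r = 0" by auto
  thus False using arg_cong[OF pq(2), of dy] by (simp add: derivation_ev derivation_dy)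
qed

section \<open>Gradings of the polynomial ring\<close>

lemma ev_altdef: "ev q a = (\<Sum>i\<le>degree q. cst (coeff q i) * a ^ i)"
  by (rule poly2_eqI) (simp add: poly2_sum poly_altdef)

text \<open>
  A grading by the integers, given by the projections \<open>comp k\<close> onto the homogeneous parts. In
  the application \<open>comp k\<close> extracts the part of weight \<open>k\<close> with respect to a torus action.
\<close>

locale plane_grading =
  fixes comp :: "int \<Rightarrow> plane_poly \<Rightarrow> plane_poly"
  assumes comp_add: "comp k (a + b) = comp k a + comp k b"
    and finite_comp: "finite {k. comp k a \<noteq> 0}"
    and comp_sum: "(\<Sum>k | comp k a \<noteq> 0. comp k a) = a"
    and comp_comp: "comp j (comp k a) = (if j = k then comp k a else 0)"
    and comp_mult: "comp i a = a \<Longrightarrow> comp j b = b \<Longrightarrow> comp (i + j) (a * b) = a * b"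
    and comp_cst: "comp 0 (cst z) = cst z"
begin

definition hom :: "int \<Rightarrow> plane_poly \<Rightarrow> bool" where
  "hom k a \<longleftrightarrow> comp k a = a"

lemma comp_0 [simp]: "comp k 0 = 0"
  using comp_add[of k 0 0] by simp

lemma comp_diff: "comp k (a - b) = comp k a - comp k b"
  using comp_add[of k "a - b" b] by simp

lemma comp_sum_distrib: "comp k (sum g S) = (\<Sum>i\<in>S. comp k (g i))"
  by (induction S rule: infinite_finite_induct) (auto simp: comp_add)

lemma hom_comp [simp]: "hom k (comp k a)"
  by (simp add: hom_def comp_comp)

lemma comp_hom: "hom k a \<Longrightarrow> comp j a = (if j = k then a else 0)"
  by (metis comp_comp hom_def)

lemma hom_0 [simp]: "hom k 0" by (simp add: hom_def)

lemma hom_mult: "hom i a \<Longrightarrow> hom j b \<Longrightarrow> hom (i + j) (a * b)"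
  by (simp add: hom_def comp_mult)

lemma hom_cst [simp]: "hom 0 (cst z)" by (simp add: hom_def comp_cst)

lemma hom_diff: "hom k a \<Longrightarrow> hom k b \<Longrightarrow> hom k (a - b)"
  by (simp add: hom_def comp_diff)

lemma hom_power: "hom k a \<Longrightarrow> hom (int n * k) (a ^ n)"
proof (induction n)
  case 0
  show ?case using hom_cst[of 1] by simp
qed (auto dest: hom_mult simp: algebra_simps)

lemma comp_sum_superset: "finite S \<Longrightarrow> {k. comp k a \<noteq> 0} \<subseteq> S \<Longrightarrow> (\<Sum>k\<in>S. comp k a) = a"
  by (subst (2) comp_sum[symmetric], rule sum.mono_neutral_right) auto

lemma hom_induct [case_names zero hom add]:
  assumes "Pr 0" "\<And>k a. hom k a \<Longrightarrow> Pr a" "\<And>a b. Pr a \<Longrightarrow> Pr b \<Longrightarrow> Pr (a + b)"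
  shows "Pr a"
proof -
  have "Pr (\<Sum>k\<in>S. comp k a)" if "finite S" for S
    using that
  proof induction
    case (insert k S)
    have "Pr (comp k a)" using assms(2) hom_comp by blast
    thus ?case using insert assms(3) by simp
  qed (use assms(1) in simp)
  thus ?thesis using comp_sum finite_comp by metis
qed

lemma comp_mult_hom:
  assumes "hom k a"
  shows "comp (m + k) (b * a) = comp m b * a"
proof (induction b rule: hom_induct)
  case (hom j b)
  have "hom (j + k) (b * a)" using hom assms by (rule hom_mult)
  thus ?case using hom by (simp add: comp_hom)
qed (auto simp: comp_add algebra_simps)

lemma top_component:
  assumes "a \<noteq> 0"
  obtains K where "comp K a \<noteq> 0" "\<And>k. k > K \<Longrightarrow> comp k a = 0"
proof -
  let ?S = "{k. comp k a \<noteq> 0}"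
  have "?S \<noteq> {}" using assms comp_sum[of a] by fastforce
  hence "comp (Max ?S) a \<noteq> 0" using Max_in[OF finite_comp] by blast
  moreover have "comp k a = 0" if "k > Max ?S" for k
    using Max_ge[OF finite_comp, of k a] that by force
  ultimately show ?thesis using that by blast
qed

lemma comp_top_mult:
  assumes "\<And>k. k > K \<Longrightarrow> comp k a = 0" "\<And>l. l > L \<Longrightarrow> comp l b = 0"
  shows "comp (K + L) (a * b) = comp K a * comp L b"
proof -
  let ?S = "insert L {k. comp k b \<noteq> 0}"
  have S: "finite ?S" using finite_comp by simp
  have "a * b = (\<Sum>l\<in>?S. a * comp l b)"
    by (subst sum_distrib_left[symmetric], subst comp_sum_superset) (use S in auto)
  hence "comp (K + L) (a * b) = (\<Sum>l\<in>?S. comp (K + L - l) a * comp l b)"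
    using comp_mult_hom[OF hom_comp] by (simp add: comp_sum_distrib) (metis diff_add_cancel)
  also have "\<dots> = (\<Sum>l\<in>{L}. comp (K + L - l) a * comp l b)"
  proof (rule sum.mono_neutral_right[OF S])
    show "\<forall>l\<in>?S - {L}. comp (K + L - l) a * comp l b = 0"
    proof
      fix l assume "l \<in> ?S - {L}"
      thus "comp (K + L - l) a * comp l b = 0"
        using assms(1)[of "K + L - l"] assms(2)[of l] by (cases "l < L") auto
    qed
  qed simp
  finally show ?thesis by simp
qed

lemma opposite_grading: "plane_grading (\<lambda>k. comp (- k))"
proof
  fix a b z and i j k :: int
  have eq: "{k. comp (- k) a \<noteq> 0} = uminus ` {k. comp k a \<noteq> 0}" by force
  show "finite {k. comp (- k) a \<noteq> 0}" unfolding eq using finite_comp by simp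
  show "(\<Sum>k | comp (- k) a \<noteq> 0. comp (- k) a) = a"
    unfolding eq by (subst sum.reindex) (auto simp: comp_sum)
  show "comp (- (i + j)) (a * b) = a * b" if "comp (- i) a = a" "comp (- j) b = b"
    using comp_mult[OF that] by simp
qed (auto simp: comp_add comp_comp comp_cst)

lemma bottom_component:
  assumes "a \<noteq> 0"
  obtains K where "comp K a \<noteq> 0" "\<And>k. k < K \<Longrightarrow> comp k a = 0"
proof -
  interpret opp: plane_grading "\<lambda>k. comp (- k)" by (rule opposite_grading)
  obtain K where "comp (- K) a \<noteq> 0" "\<And>k. k > K \<Longrightarrow> comp (- k) a = 0"
    using opp.top_component[OF assms] by blast
  thus ?thesis using that[of "- K"] by (metis add.inverse_inverse neg_less_iff_less)
qed

lemma comp_bottom_mult: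
  assumes "\<And>k. k < K \<Longrightarrow> comp k a = 0" "\<And>l. l < L \<Longrightarrow> comp l b = 0"
  shows "comp (K + L) (a * b) = comp K a * comp L b"
proof -
  interpret opp: plane_grading "\<lambda>k. comp (- k)" by (rule opposite_grading)
  show ?thesis
    using opp.comp_top_mult[of "- K" a "- L" b] assms by (simp add: minus_less_iff add.commute)
qed

text \<open>Otherwise the products of the top and of the bottom components would differ in weight.\<close>

lemma homogeneous_factors:
  assumes ab: "hom m (a * b)" "a * b \<noteq> 0"
  shows "\<exists>i j. hom i a \<and> hom j b"
proof -
  have nz: "a \<noteq> 0" "b \<noteq> 0" using ab by auto
  obtain K where K: "comp K a \<noteq> 0" "\<And>k. k > K \<Longrightarrow> comp k a = 0" using top_component nz by blast
  obtain L where L: "comp L b \<noteq> 0" "\<And>k. k > L \<Longrightarrow> comp k b = 0" using top_component nz by blast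
  obtain K' where K': "comp K' a \<noteq> 0" "\<And>k. k < K' \<Longrightarrow> comp k a = 0" using bottom_component nz by blast
  obtain L' where L': "comp L' b \<noteq> 0" "\<And>k. k < L' \<Longrightarrow> comp k b = 0" using bottom_component nz by blast
  have "comp (K + L) (a * b) \<noteq> 0" "comp (K' + L') (a * b) \<noteq> 0"
    using comp_top_mult[OF K(2) L(2)] comp_bottom_mult[OF K'(2) L'(2)] K L K' L' by auto
  hence "K + L = K' + L'" using comp_hom[OF ab(1)] by metis
  moreover have "K' \<le> K" "L' \<le> L" using K L K' L' by force+
  ultimately have "K = K'" "L = L'" by auto
  hence "comp k a = 0" if "k \<noteq> K" for k using that K K' by (metis linorder_neqE)
  moreover have "comp l b = 0" if "l \<noteq> L" for l using that L L' \<open>L = L'\<close> by (metis linorder_neqE)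
  ultimately have "{k. comp k a \<noteq> 0} \<subseteq> {K}" "{l. comp l b \<noteq> 0} \<subseteq> {L}" by auto
  hence "comp K a = a" "comp L b = b"
    using comp_sum_superset[of "{K}" a] comp_sum_superset[of "{L}" b] by auto
  thus ?thesis by (auto simp: hom_def)
qed

section \<open>Homogeneous locally nilpotent derivations\<close>

text \<open>
  The acronym stands for homogeneous locally nilpotent derivation; the zero derivation is
  excluded, so that minimal elements with this property are informative.
\<close>

definition hlnd :: "int \<Rightarrow> (plane_poly \<Rightarrow> plane_poly) \<Rightarrow> bool" where
  "hlnd d E \<longleftrightarrow> derivation E \<and> locally_nilpotent E \<and> (\<exists>a. E a \<noteq> 0) \<and>
     (\<forall>k a. hom k a \<longrightarrow> hom (k + d) (E a))"

lemma comp_hlnd: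
  assumes "hlnd d E"
  shows "comp (k + d) (E a) = E (comp k a)"
proof (induction a rule: hom_induct)
  case (hom j a)
  hence *: "hom (j + d) (E a)" using assms by (auto simp: hlnd_def)
  have "derivation E" using assms by (simp add: hlnd_def)
  thus ?case by (simp add: comp_hom[OF *] comp_hom[OF hom] derivationD)
qed (use assms in \<open>auto simp: hlnd_def derivationD comp_add\<close>)

text \<open>The component of weight \<open>k\<close> of the derivation \<open>dx\<close>.\<close>

definition dx_comp :: "int \<Rightarrow> plane_poly \<Rightarrow> plane_poly" where
  "dx_comp k a = (\<Sum>j | comp j a \<noteq> 0. comp (j + k) (dx (comp j a)))"

lemma dx_comp_superset:
  assumes "finite S" "{j. comp j a \<noteq> 0} \<subseteq> S"
  shows "dx_comp k a = (\<Sum>j\<in>S. comp (j + k) (dx (comp j a)))"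
  unfolding dx_comp_def
  by (rule sum.mono_neutral_left) (use assms derivationD[OF derivation_dx] in auto)

lemma dx_comp_add: "dx_comp k (a + b) = dx_comp k a + dx_comp k b"
proof -
  let ?S = "{j. comp j a \<noteq> 0} \<union> {j. comp j b \<noteq> 0}"
  have S: "finite ?S" using finite_comp by simp
  have "{j. comp j (a + b) \<noteq> 0} \<subseteq> ?S" by (auto simp: comp_add)
  thus ?thesis using dx_comp_superset[OF S]
    by (auto simp: comp_add derivationD[OF derivation_dx] sum.distrib)
qed

lemma dx_comp_hom:
  assumes "hom j a"
  shows "dx_comp k a = comp (j + k) (dx a)"
  by (subst dx_comp_superset[of "{j}"]) (use comp_hom[OF assms] in \<open>auto split: if_splits\<close>)

lemma dx_comp_0 [simp]: "dx_comp k 0 = 0"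
  by (simp add: dx_comp_def)

lemma derivation_dx_comp: "derivation (dx_comp k)"
proof -
  have "dx_comp k (cst z) = 0" for z
    using dx_comp_hom[OF hom_cst] by (simp add: derivationD[OF derivation_dx])
  moreover have "dx_comp k (a * b) = dx_comp k a * b + a * dx_comp k b" for a b
  proof (induction a rule: hom_induct)
    case a: (hom i a)
    show ?case
    proof (induction b rule: hom_induct)
      case b: (hom j b)
      have "dx_comp k (a * b) = comp (i + j + k) (dx a * b + a * dx b)"
        using dx_comp_hom[OF hom_mult[OF a b]] by (simp add: derivationD[OF derivation_dx])
      also have "\<dots> = comp (i + k + j) (dx a * b) + comp (j + k + i) (dx b * a)"
        by (simp add: comp_add algebra_simps)
      also have "\<dots> = comp (i + k) (dx a) * b + comp (j + k) (dx b) * a"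
        using a b by (simp only: comp_mult_hom)
      finally show ?case using a b by (simp add: dx_comp_hom mult.commute)
    qed (auto simp: dx_comp_add algebra_simps)
  qed (auto simp: dx_comp_add algebra_simps)
  ultimately show ?thesis by (auto simp: derivation_def dx_comp_add)
qed

lemma finite_dx_comp: "finite {k. dx_comp k a \<noteq> 0}"
proof (rule finite_subset)
  show "{k. dx_comp k a \<noteq> 0} \<subseteq>
      (\<Union>j\<in>{j. comp j a \<noteq> 0}. (\<lambda>m. m - j) ` {m. comp m (dx (comp j a)) \<noteq> 0})"
  proof
    fix k assume "k \<in> {k. dx_comp k a \<noteq> 0}"
    then obtain j where j: "comp j a \<noteq> 0" "comp (j + k) (dx (comp j a)) \<noteq> 0"
      unfolding dx_comp_def by (metis (mono_tags, lifting) mem_Collect_eq sum.neutral)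
    hence "k \<in> (\<lambda>m. m - j) ` {m. comp m (dx (comp j a)) \<noteq> 0}"
      by (intro image_eqI[of _ _ "j + k"]) auto
    thus "k \<in> (\<Union>j\<in>{j. comp j a \<noteq> 0}. (\<lambda>m. m - j) ` {m. comp m (dx (comp j a)) \<noteq> 0})"
      using j by blast
  qed
qed (use finite_comp in auto)

lemma locally_nilpotent_dx: "locally_nilpotent dx"
  unfolding locally_nilpotent_def
proof
  have pd: "\<exists>n. (pderiv ^^ n) p = 0" for p :: "complex poly"
  proof (induction "degree p" arbitrary: p rule: less_induct)
    case less
    show ?case
    proof (cases "degree p = 0")
      case True
      hence "(pderiv ^^ 1) p = 0" by (simp add: pderiv_eq_0_iff)
      thus ?thesis by blast
    next
      case False
      then obtain n where "(pderiv ^^ n) (pderiv p) = 0"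
        using less[of "pderiv p"] by (auto simp: degree_pderiv)
      thus ?thesis by (intro exI[of _ "Suc n"]) (simp add: funpow_swap1)
    qed
  qed
  have pd_0: "(pderiv ^^ n) 0 = (0 :: complex poly)" for n by (induction n) auto
  fix a show "\<exists>n. (dx ^^ n) a = 0"
  proof (induction a)
    case 0
    show ?case by (auto intro: exI[of _ 0])
  next
    case (pCons p a)
    obtain m n where mn: "(pderiv ^^ m) p = 0" "(dx ^^ n) a = 0" using pd pCons by blast
    have "(dx ^^ k) (pCons p a) = pCons ((pderiv ^^ k) p) ((dx ^^ k) a)" for k
      by (induction k) (auto simp: dx_pCons)
    moreover have "(pderiv ^^ (m + n)) p = 0"
      using mn(1) by (subst add.commute) (simp add: funpow_add pd_0)
    ultimately show ?case
      using funpow_derivation_ge[OF derivation_dx mn(2), of "m + n"] by (intro exI[of _ "m + n"]) simp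
  qed
qed

text \<open>
  The component of highest weight \<open>d\<close> of \<open>dx\<close> is locally nilpotent, because its iterates are the
  components of highest weight of the iterates of \<open>dx\<close>.
\<close>

lemma ex_hlnd: "\<exists>d E. hlnd d E"
proof -
  define D where "D = {k. \<exists>a. dx_comp k a \<noteq> 0}"
  have "D \<subseteq> {k. dx_comp k X \<noteq> 0} \<union> {k. dx_comp k Y \<noteq> 0}"
  proof
    fix k assume "k \<in> D"
    then obtain a where "dx_comp k a \<noteq> 0" by (auto simp: D_def)
    moreover have "dx_comp k a = dx a * dx_comp k X + dy a * dx_comp k Y"
      by (rule derivation_expand[OF derivation_dx_comp])
    ultimately show "k \<in> {k. dx_comp k X \<noteq> 0} \<union> {k. dx_comp k Y \<noteq> 0}" by auto
  qed
  hence "finite D" using finite_dx_comp finite_subset by blast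
  have "D \<noteq> {}"
  proof -
    have "\<exists>j. dx (comp j X) \<noteq> 0"
    proof (rule ccontr)
      assume "\<not> ?thesis"
      hence "dx (\<Sum>k | comp k X \<noteq> 0. comp k X) = 0"
        by (simp add: derivation_sum[OF derivation_dx])
      thus False by (simp add: comp_sum)
    qed
    then obtain j where j: "dx (comp j X) \<noteq> 0" by blast
    then obtain m where "comp m (dx (comp j X)) \<noteq> 0" using top_component by blast
    hence "dx_comp (m - j) (comp j X) \<noteq> 0" using dx_comp_hom[OF hom_comp] by simp
    thus ?thesis by (auto simp: D_def)
  qed
  define d where "d = Max D"
  have "d \<in> D" using \<open>finite D\<close> \<open>D \<noteq> {}\<close> by (simp add: d_def)
  have high: "dx_comp k a = 0" if "k > d" for k a
    using Max_ge[OF \<open>finite D\<close>, of k] that by (fastforce simp: D_def d_def)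
  let ?E = "dx_comp d"
  have E: "derivation ?E" by (rule derivation_dx_comp)
  have iter: "comp (j + int n * d) ((dx ^^ n) a) = (?E ^^ n) a \<and>
      (\<forall>m > j + int n * d. comp m ((dx ^^ n) a) = 0)" if "hom j a" for j n a
  proof (induction n)
    case 0
    show ?case using comp_hom[OF that] by auto
  next
    case (Suc n)
    define b where "b = (dx ^^ n) a"
    define M where "M = j + int n * d"
    let ?S = "insert M {m. comp m b \<noteq> 0}"
    have S: "finite ?S" using finite_comp by simp
    have "comp (m + d) (dx b) = (if m = M then ?E (comp M b) else 0)" if "m \<ge> M" for m
    proof -
      have "(\<Sum>l\<in>?S. comp l b) = b" by (rule comp_sum_superset[OF S]) auto
      hence "comp (m + d) (dx b) = comp (m + d) (dx (\<Sum>l\<in>?S. comp l b))" by (simp only:)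
      also have "\<dots> = (\<Sum>l\<in>?S. comp (m + d) (dx (comp l b)))"
        by (simp only: derivation_sum[OF derivation_dx] comp_sum_distrib)
      also have "\<dots> = (\<Sum>l\<in>?S. dx_comp (m + d - l) (comp l b))"
        using dx_comp_hom[OF hom_comp] by simp
      also have "\<dots> = (\<Sum>l\<in>?S. if l = M then (if m = M then ?E (comp M b) else 0) else 0)"
      proof (rule sum.cong[OF refl])
        fix l assume "l \<in> ?S"
        hence "l \<le> M" using Suc.IH by (force simp: b_def M_def)
        thus "dx_comp (m + d - l) (comp l b) =
            (if l = M then (if m = M then ?E (comp M b) else 0) else 0)"
          using high[of "m + d - l"] \<open>m \<ge> M\<close> by auto
      qed
      also have "\<dots> = (if m = M then ?E (comp M b) else 0)" using S by simp
      finally show ?thesis .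
    qed
    note step = this
    have "comp (j + int (Suc n) * d) ((dx ^^ Suc n) a) = (?E ^^ Suc n) a"
      using step[of M] Suc.IH by (simp add: b_def M_def algebra_simps)
    moreover have "comp m ((dx ^^ Suc n) a) = 0" if "m > j + int (Suc n) * d" for m
      using step[of "m - d"] that by (simp add: b_def M_def algebra_simps)
    ultimately show ?case by blast
  qed
  have "locally_nilpotent ?E"
    unfolding locally_nilpotent_def
  proof
    fix a show "\<exists>n. (?E ^^ n) a = 0"
    proof (induction a rule: hom_induct)
      case zero
      show ?case by (auto intro: exI[of _ 0])
    next
      case (hom j a)
      obtain n where "(dx ^^ n) a = 0" using locally_nilpotent_dx by (auto simp: locally_nilpotent_def)
      thus ?case using iter[OF hom, of n] by (auto intro: exI[of _ n])
    next
      case (add a b)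
      then obtain m n where "(?E ^^ m) a = 0" "(?E ^^ n) b = 0" by blast
      hence "(?E ^^ (m + n)) (a + b) = 0"
        using funpow_derivation_ge[OF E] funpow_derivation_add[OF E] by simp
      thus ?case by blast
    qed
  qed
  moreover have "hom (k + d) (?E a)" if "hom k a" for k a
    using dx_comp_hom[OF that] by simp
  ultimately have "hlnd d ?E" using E \<open>d \<in> D\<close> by (auto simp: hlnd_def D_def)
  thus ?thesis by blast
qed

lemma hlnd_divide:
  assumes E: "hlnd d E" and F: "hom w F" "F \<noteq> 0" "E F = 0" "\<And>a. F dvd E a"
  shows "hlnd (d - w) (\<lambda>a. E a div F)"
proof -
  define E' where "E' a = E a div F" for a
  have FE: "E a = F * E' a" for a using F by (simp add: E'_def)
  have der: "derivation E" using E by (simp add: hlnd_def)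
  have eqI: "b = c" if "F * b = F * c" for b c using that F by simp
  have "E' (cst z) = 0" for z by (simp add: E'_def derivationD[OF der])
  moreover have "E' (a + b) = E' a + E' b" for a b
  proof (rule eqI)
    have "F * E' (a + b) = E a + E b" by (simp only: FE[symmetric] derivationD[OF der])
    thus "F * E' (a + b) = F * (E' a + E' b)" by (simp only: FE distrib_left)
  qed
  moreover have "E' (a * b) = E' a * b + a * E' b" for a b
  proof (rule eqI)
    have "F * E' (a * b) = E a * b + a * E b" by (simp only: FE[symmetric] derivationD[OF der])
    thus "F * E' (a * b) = F * (E' a * b + a * E' b)" by (simp add: FE algebra_simps)
  qed
  ultimately have E': "derivation E'" by (simp add: derivation_def)
  have "E' F = 0" using F by (simp add: E'_def)
  hence "E' (F ^ n) = 0" for n by (induction n) (auto simp: derivationD[OF E'])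
  hence "(E ^^ n) a = F ^ n * (E' ^^ n) a" for n a
    by (induction n) (auto simp: FE derivationD[OF E'])
  hence "locally_nilpotent E'"
    using E F by (simp add: hlnd_def locally_nilpotent_def)
  moreover have "\<exists>a. E' a \<noteq> 0" using E by (force simp: hlnd_def FE)
  moreover have "hom (k + (d - w)) (E' a)" if "hom k a" for k a
  proof -
    have EF: "E' a * F = E a" by (simp add: FE)
    have "hom (k + d) (E a)" using E that by (auto simp: hlnd_def)
    hence "comp (k + d - w + w) (E' a * F) = E' a * F" by (simp add: EF hom_def)
    hence "comp (k + d - w) (E' a) * F = E' a * F" by (simp only: comp_mult_hom[OF F(1)])
    hence "comp (k + d - w) (E' a) = E' a" using F by simp
    thus ?thesis by (simp add: hom_def algebra_simps)
  qed
  ultimately have "hlnd (d - w) E'" using E' by (auto simp: hlnd_def)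
  thus ?thesis unfolding E'_def .
qed

definition irreducible_hlnd :: "int \<Rightarrow> (plane_poly \<Rightarrow> plane_poly) \<Rightarrow> bool" where
  "irreducible_hlnd d E \<longleftrightarrow> hlnd d E \<and>
     (\<forall>w F. hom w F \<longrightarrow> E F = 0 \<longrightarrow> F \<notin> range cst \<longrightarrow> \<not> F dvd E X \<or> \<not> F dvd E Y)"

text \<open>
  Take the images of \<open>X\<close> and \<open>Y\<close> of least possible degree: a quotient of the derivation by a
  nonconstant homogeneous element of its kernel would be smaller and of the same kind.
\<close>

lemma ex_irreducible_hlnd: "\<exists>d E. irreducible_hlnd d E"
proof -
  define m :: "int \<times> (plane_poly \<Rightarrow> plane_poly) \<Rightarrow> nat"
    where "m = (\<lambda>(d, E). pdeg (E X) + pdeg (E Y))"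
  obtain p where p: "case p of (d, E) \<Rightarrow> hlnd d E"
      "\<And>p'. case p' of (d, E) \<Rightarrow> hlnd d E \<Longrightarrow> m p \<le> m p'"
    using ex_hlnd ex_has_least_nat[of "\<lambda>(d, E). hlnd d E" _ m] by (metis (mono_tags, lifting) case_prodI)
  obtain d E where dE: "p = (d, E)" by force
  have E: "hlnd d E" using p(1) dE by simp
  hence der: "derivation E" by (simp add: hlnd_def)
  have "\<not> F dvd E X \<or> \<not> F dvd E Y" if F: "hom w F" "E F = 0" "F \<notin> range cst" for w F
  proof (rule ccontr)
    assume "\<not> ?thesis"
    hence dvd: "F dvd E X" "F dvd E Y" by auto
    hence "F dvd E a" for a using derivation_expand[OF der, of a] by simp
    moreover have "F \<noteq> 0" using F(3) cst_simps(1) by (metis rangeI)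
    ultimately have "hlnd (d - w) (\<lambda>a. E a div F)" using hlnd_divide[OF E] F by blast
    hence le: "m (d, E) \<le> m (d - w, \<lambda>a. E a div F)" using p(2) dE by simp
    have "pdeg F > 0" using F(3) pdeg_eq_0_iff by blast
    have drop: "pdeg (P div F) \<le> pdeg P \<and> (P \<noteq> 0 \<longrightarrow> pdeg (P div F) < pdeg P)" if P: "F dvd P" for P
    proof (cases "P = 0")
      case False
      obtain Q where "P = F * Q" using P unfolding dvd_def by blast
      moreover from this have "Q \<noteq> 0" "P div F = Q" using False \<open>F \<noteq> 0\<close> by auto
      ultimately show ?thesis using \<open>F \<noteq> 0\<close> \<open>pdeg F > 0\<close> by (simp add: pdeg_mult)
    qed auto
    have "E X \<noteq> 0 \<or> E Y \<noteq> 0"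
    proof (rule ccontr)
      assume "\<not> ?thesis"
      hence "E a = 0" for a using derivation_expand[OF der, of a] by simp
      thus False using E by (simp add: hlnd_def)
    qed
    thus False using le drop[OF dvd(1)] drop[OF dvd(2)] by (auto simp: m_def)
  qed
  hence "irreducible_hlnd d E" using E unfolding irreducible_hlnd_def by blast
  thus ?thesis by blast
qed

section \<open>Homogeneous coordinates\<close>

context
  fixes d E
  assumes irred: "irreducible_hlnd d E"
begin

lemma E: "hlnd d E"
  using irred by (simp add: irreducible_hlnd_def)

lemma derE: "derivation E" and nilE: "locally_nilpotent E"
  using E by (auto simp: hlnd_def)

text \<open>
  A nonconstant homogeneous element of least degree in the kernel of \<open>E\<close>. Its powers will turn
  out to span the kernel.
\<close>

definition generator :: "plane_poly \<Rightarrow> bool" where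
  "generator f \<longleftrightarrow> E f = 0 \<and> f \<notin> range cst \<and> (\<exists>w. hom w f) \<and>
     (\<forall>g w. E g = 0 \<longrightarrow> g \<notin> range cst \<longrightarrow> hom w g \<longrightarrow> pdeg f \<le> pdeg g)"

lemma ex_generator: "\<exists>f. generator f"
proof -
  obtain a where "E a \<noteq> 0" using E by (auto simp: hlnd_def)
  then obtain f where f: "E f = 0" "f \<notin> range cst" using kernel_nonconstant derE nilE by blast
  have "\<exists>k. comp k f \<notin> range cst"
  proof (rule ccontr)
    assume "\<not> ?thesis"
    hence *: "comp k f \<in> range cst" for k by blast
    have "(\<Sum>k\<in>S. comp k f) \<in> range cst" for S
    proof (induction S rule: infinite_finite_induct)
      case (insert k S)
      thus ?case using *[of k] by (auto simp flip: cst_simps)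
    qed (auto intro: range_eqI[of _ _ 0])
    thus False using f comp_sum by metis
  qed
  then obtain k where "comp k f \<notin> range cst" by blast
  moreover have "E (comp k f) = 0" using comp_hlnd[OF E, of k f] f by simp
  ultimately obtain g where "E g = 0 \<and> g \<notin> range cst \<and> (\<exists>w. hom w g)" using hom_comp by blast
  from ex_has_least_nat[of "\<lambda>g. E g = 0 \<and> g \<notin> range cst \<and> (\<exists>w. hom w g)", OF this, of pdeg]
  show ?thesis unfolding generator_def by blast
qed

lemma generator_nonzero: "generator f \<Longrightarrow> f \<noteq> 0"
  unfolding generator_def by (metis cst_simps(1) rangeI)

text \<open>
  Both factors of a product in the kernel are in the kernel and homogeneous, so minimality of the
  degree makes one of them constant.
\<close>

lemma generator_prime:
  assumes f: "generator f"
  shows "prime_elem f"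
proof -
  have "irreducible f"
  proof (rule irreducibleI)
    show "f \<noteq> 0" using f by (rule generator_nonzero)
    show "\<not> f dvd 1" using f by (auto simp: unit_iff_cst generator_def)
    fix a b assume ab: "f = a * b"
    have nz: "a \<noteq> 0" "b \<noteq> 0" using ab \<open>f \<noteq> 0\<close> by auto
    have ker: "E a = 0" "E b = 0"
      using kernel_factorially_closed[OF derE nilE, of a b] f ab \<open>f \<noteq> 0\<close> by (auto simp: generator_def)
    obtain i j where ij: "hom i a" "hom j b"
      using homogeneous_factors ab f \<open>f \<noteq> 0\<close> unfolding generator_def by metis
    have "a \<in> range cst \<or> b \<in> range cst"
    proof (rule ccontr)
      assume "\<not> ?thesis"
      hence "pdeg f \<le> pdeg a" "pdeg b \<noteq> 0"
        using f ker ij pdeg_eq_0_iff by (auto simp: generator_def)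
      thus False using pdeg_mult[OF nz] ab by simp
    qed
    thus "a dvd 1 \<or> b dvd 1" using nz by (auto simp: unit_iff_cst)
  qed
  thus ?thesis by (simp add: irreducible_imp_prime_elem)
qed

lemma constant_mod_generator:
  assumes f: "generator f" and a: "f dvd E a"
  shows "\<exists>\<mu>. f dvd a - cst \<mu>"
proof -
  have "E f = 0" using f by (simp add: generator_def)
  moreover obtain r where "\<not> f dvd E r" using irred f unfolding generator_def irreducible_hlnd_def by metis
  ultimately show ?thesis
    using constant_mod_prime[OF derE generator_prime[OF f]] a by simp
qed

text \<open>Subtract a constant to make \<open>g\<close> divisible by \<open>f\<close>, and apply induction to the quotient.\<close>

lemma kernel_generated:
  assumes f: "generator f"
  shows "E g = 0 \<Longrightarrow> \<exists>q. g = ev q f"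
proof (induction "pdeg g" arbitrary: g rule: less_induct)
  case less
  show ?case
  proof (cases "g \<in> range cst")
    case True
    then obtain c where "g = cst c" by auto
    thus ?thesis by (intro exI[of _ "[:c:]"]) simp
  next
    case False
    obtain \<mu> where "f dvd g - cst \<mu>" using constant_mod_generator[OF f, of g] less.prems by auto
    then obtain h where h: "g - cst \<mu> = f * h" by (auto elim: dvdE)
    have "E f = 0" "pdeg f > 0" using f pdeg_eq_0_iff by (auto simp: generator_def)
    have "g - cst \<mu> \<noteq> 0" using False by auto
    hence nz: "f \<noteq> 0" "h \<noteq> 0" using h by auto
    have "pdeg g = pdeg f + pdeg h" using pdeg_diff_cst[of g \<mu>] h nz by (simp add: pdeg_mult)
    moreover have "f * E h = 0"
      using arg_cong[OF h, of E] less.prems \<open>E f = 0\<close> by (simp add: derivationD[OF derE])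
    hence "E h = 0" using nz by simp
    ultimately obtain q where "h = ev q f" using less.hyps[of h] \<open>pdeg f > 0\<close> by auto
    hence "g = ev (pCons \<mu> q) f" using h by (simp add: algebra_simps)
    thus ?thesis by blast
  qed
qed

text \<open>
  The powers of \<open>f\<close> have distinct weights, so a homogeneous polynomial in \<open>f\<close> is a single power
  up to a constant factor.
\<close>

lemma homogeneous_ev_constant_term:
  assumes "hom w f" "w \<noteq> 0" "f \<notin> range cst" "hom k (ev q f)" "degree q > 0"
  shows "coeff q 0 = 0"
proof -
  have "f \<noteq> 0" using assms(3) by (metis cst_simps(1) rangeI)
  have "hom (0 + int i * w) (cst (coeff q i) * f ^ i)" for i
    by (intro hom_mult hom_cst hom_power assms)
  hence "comp (int n * w) (cst (coeff q i) * f ^ i) = (if n = i then cst (coeff q i) * f ^ i else 0)"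
    for n i using comp_hom[of "int i * w" "cst (coeff q i) * f ^ i" "int n * w"] assms(2) by auto
  hence c: "comp (int n * w) (ev q f) = cst (coeff q n) * f ^ n" if "n \<le> degree q" for n
    using that by (simp add: ev_altdef comp_sum_distrib)
  have "comp (int (degree q) * w) (ev q f) \<noteq> 0"
    using assms(5) \<open>f \<noteq> 0\<close> by (subst c) auto
  hence "k = int (degree q) * w" using comp_hom[OF assms(4)] by metis
  hence "comp (int 0 * w) (ev q f) = 0" using comp_hom[OF assms(4)] assms by simp
  thus ?thesis by (subst (asm) c) auto
qed

text \<open>
  Among the homogeneous \<open>s\<close> with \<open>E s = q f\<close> for a polynomial \<open>q \<noteq> 0\<close>, take one for which \<open>q\<close> has
  least degree. If \<open>q\<close> had a root \<open>\<nu>\<close>, then \<open>E s\<close> would be divisible by \<open>f - \<nu>\<close>, hence so would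
  be \<open>s - \<mu>\<close> for some constant \<open>\<mu>\<close>, and a component of the quotient would do with a smaller \<open>q\<close>.
\<close>

lemma homogeneous_slice:
  assumes f: "generator f"
  shows "\<exists>s b e. hom b s \<and> E s = cst e \<and> e \<noteq> 0"
proof -
  define Q where "Q p \<longleftrightarrow> (\<exists>b. hom b (fst p)) \<and> E (fst p) = ev (snd p) f \<and> snd p \<noteq> 0"
    for p :: "plane_poly \<times> complex poly"
  have "\<exists>p. Q p"
  proof -
    obtain r where r: "E r \<noteq> 0" "E (E r) = 0" using local_slice[OF nilE _ derE] E unfolding hlnd_def by blast
    obtain k where k: "comp k (E r) \<noteq> 0" using top_component[OF r(1)] by blast
    have "E (comp (k - d) r) = comp k (E r)" using comp_hlnd[OF E, of "k - d" r] by simp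
    moreover have "E (comp k (E r)) = 0" using comp_hlnd[OF E, of k "E r"] r by simp
    then obtain q where "comp k (E r) = ev q f" using kernel_generated[OF f] by blast
    ultimately have "Q (comp (k - d) r, q)" using k by (auto simp: Q_def intro: exI[of _ "k - d"])
    thus ?thesis by blast
  qed
  then obtain p where "Q p" and least: "\<And>p'. Q p' \<Longrightarrow> degree (snd p) \<le> degree (snd p')"
    using ex_has_least_nat[of Q _ "\<lambda>p. degree (snd p)"] by metis
  obtain s q where p: "p = (s, q)" by force
  obtain b where s: "hom b s" "E s = ev q f" "q \<noteq> 0" using \<open>Q p\<close> p by (auto simp: Q_def)
  obtain w where w: "hom w f" using f by (auto simp: generator_def)
  have "degree q = 0"
  proof (rule ccontr)
    assume deg: "degree q \<noteq> 0"
    have "hom (b + d) (ev q f)" using s E unfolding hlnd_def by metis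
    \<comment> \<open>If \<open>w = 0\<close>, the elements \<open>f - \<nu>\<close> are homogeneous, hence generators too, and any root will
      do. If \<open>w \<noteq> 0\<close>, only \<open>\<nu> = 0\<close> is possible, and homogeneity of \<open>q f\<close> makes it a root.\<close>
    have "\<exists>\<nu>. poly q \<nu> = 0 \<and> generator (f - cst \<nu>) \<and> hom w (f - cst \<nu>)"
    proof (cases "w = 0")
      case True
      obtain \<nu> where "poly q \<nu> = 0"
        using deg fundamental_theorem_of_algebra constant_degree by metis
      moreover have h: "hom w (f - cst \<nu>)" using w True by (auto intro: hom_diff)
      moreover have "f - cst \<nu> \<notin> range cst"
        using f by (auto simp: generator_def algebra_simps simp flip: cst_simps)
      hence "generator (f - cst \<nu>)"
        using f h by (auto simp: generator_def pdeg_diff_cst derivationD[OF derE])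
      ultimately show ?thesis by blast
    next
      case False
      have "coeff q 0 = 0"
        using homogeneous_ev_constant_term[OF w False] f \<open>hom (b + d) (ev q f)\<close> deg
        by (auto simp: generator_def)
      thus ?thesis using f w by (intro exI[of _ 0]) (simp add: poly_0_coeff_0)
    qed
    then obtain \<nu> where root: "poly q \<nu> = 0" and F: "generator (f - cst \<nu>)" "hom w (f - cst \<nu>)"
      by blast
    define F where "F = f - cst \<nu>"
    obtain q1 where q1: "q = [:- \<nu>, 1:] * q1" using root by (auto simp: poly_eq_0_iff_dvd elim: dvdE)
    have Es: "E s = F * ev q1 f" by (simp add: s F_def q1 ev_mult del: mult_pCons_left)
    have gF: "generator F" "hom w F" using F by (simp_all only: F_def)
    have "F dvd E s" unfolding Es by simp
    then obtain \<mu> where "F dvd s - cst \<mu>" using constant_mod_generator[OF gF(1)] by blast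
    then obtain t where t: "s - cst \<mu> = F * t" unfolding dvd_def by blast
    have "E F = 0" using gF(1) unfolding generator_def by blast
    have "F \<noteq> 0" using gF(1) by (rule generator_nonzero)
    have "E s = F * E t"
      using arg_cong[OF t, of E] \<open>E F = 0\<close> by (simp add: derivationD[OF derE])
    hence Et: "E t = ev q1 f" using Es \<open>F \<noteq> 0\<close> by simp
    have "hom (b + d) (E t * F)"
      using \<open>hom (b + d) (ev q f)\<close> s \<open>E s = F * E t\<close> by (simp add: mult.commute)
    hence "comp (b - w + d + w) (E t * F) = E t * F" by (simp add: hom_def)
    hence "comp (b - w + d) (E t) * F = E t * F" by (simp only: comp_mult_hom[OF gF(2)])
    hence "E (comp (b - w) t) = E t" using \<open>F \<noteq> 0\<close> comp_hlnd[OF E, of "b - w" t] by simp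
    hence "Q (comp (b - w) t, q1)" using Et q1 s by (auto simp: Q_def intro: exI[of _ "b - w"])
    hence "degree q \<le> degree q1" using least p by fastforce
    thus False using q1 s by (auto simp: degree_mult_eq simp del: mult_pCons_left)
  qed
  then obtain e where "q = [:e:]" by (metis degree_eq_zeroE)
  thus ?thesis using s by (intro exI[of _ s] exI[of _ b] exI[of _ e]) auto
qed

end

text \<open>
  Take an irreducible derivation \<open>E\<close>, a generator \<open>f\<close> of its kernel and a homogeneous \<open>s\<close> for which
  \<open>E s\<close> is a nonzero constant. The ring is generated by \<open>s\<close> over the kernel \<open>\<complex>[f]\<close>; and \<open>s\<close> is
  transcendental over the kernel, as \<open>f\<close> is over \<open>\<complex>\<close>.
\<close>

theorem homogeneous_coordinates:
  obtains f s a b where "hom a f" "hom b s"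
    "\<And>g. \<exists>R. g = subst R f s" "\<And>R. subst R f s = 0 \<Longrightarrow> R = 0"
proof -
  obtain d E where irred: "irreducible_hlnd d E" using ex_irreducible_hlnd by blast
  hence E: "hlnd d E" by (simp add: irreducible_hlnd_def)
  have der: "derivation E" and nil: "locally_nilpotent E" using E by (auto simp: hlnd_def)
  obtain f where f: "generator E f" using ex_generator[OF irred] by blast
  obtain a where a: "hom a f" using f by (auto simp: generator_def[OF irred])
  obtain s b e where s: "hom b s" "E s = cst e" "e \<noteq> 0"
    using homogeneous_slice[OF irred f] by blast
  have f': "f \<notin> range cst" "E f = 0" using f by (auto simp: generator_def[OF irred])
  have "\<exists>R. g = subst R f s" for g
  proof -
    obtain n where "(E ^^ n) g = 0" using nil by (auto simp: locally_nilpotent_def)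
    then obtain H where H: "\<And>k. E (coeff H k) = 0" "g = poly H s"
      using slice_expansion[OF der s(2,3)] by blast
    have "coeff H k \<in> range (\<lambda>p. ev p f)" for k
      using kernel_generated[OF irred f H(1)[of k]] by auto
    then obtain R where "H = map_poly (\<lambda>p. ev p f) R" using map_poly_exists[of "\<lambda>p. ev p f" H] by auto
    thus ?thesis using H by (auto simp: subst_def)
  qed
  moreover have "R = 0" if "subst R f s = 0" for R
  proof -
    have "map_poly (\<lambda>p. ev p f) R = 0"
      by (rule kernel_coeffs_independent[OF der, of s])
        (use s that f' in \<open>auto simp: subst_def coeff_map_poly derivation_ev[OF der]\<close>)
    hence "ev (coeff R k) f = 0" for k by (metis (mono_tags) coeff_map_poly ev_0 coeff_0)
    hence "coeff R k = 0" for k using ev_eq_0_imp_eq_0 f' by blast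
    thus ?thesis by (intro poly_eqI) simp
  qed
  ultimately show ?thesis using that[OF a s(1)] by blast
qed

end

section \<open>Linearisation of torus actions\<close>

text \<open>Multiplication by a power of \<open>t\<close> reduces this to ordinary polynomials.\<close>

lemma laurent_coeffs_zero:
  fixes a :: "int \<Rightarrow> complex"
  assumes K: "finite K" and zero: "\<And>t. t \<noteq> 0 \<Longrightarrow> (\<Sum>k\<in>K. t powi k * a k) = 0" and k: "k \<in> K"
  shows "a k = 0"
proof -
  define N where "N = Max (insert 0 ((\<lambda>k. - k) ` K))"
  have N: "l + N \<ge> 0" if "l \<in> K" for l
  proof -
    have "- l \<le> N" unfolding N_def using K that by (intro Max_ge) auto
    thus ?thesis by simp
  qed
  define p where "p = (\<Sum>k\<in>K. monom (a k) (nat (k + N)))"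
  have "poly p t = 0" if "t \<noteq> 0" for t
  proof -
    have "poly p t = (\<Sum>k\<in>K. t powi N * (t powi k * a k))"
      unfolding p_def poly_sum
    proof (rule sum.cong[OF refl])
      fix l assume "l \<in> K"
      have "t ^ nat (l + N) = t powi (l + N)"
        using N[OF \<open>l \<in> K\<close>] by (simp add: power_int_def)
      thus "poly (monom (a l) (nat (l + N))) t = t powi N * (t powi l * a l)"
        using that by (simp add: poly_monom power_int_add)
    qed
    also have "\<dots> = 0" using zero[OF that] by (simp flip: sum_distrib_left)
    finally show ?thesis .
  qed
  hence "- {0} \<subseteq> {t. poly p t = 0}" by auto
  moreover have "infinite (- {0 :: complex})"
    using infinite_UNIV_char_0[where 'a = complex] by (simp add: Compl_eq_Diff_UNIV)
  ultimately have "p = 0" using poly_roots_finite[of p] finite_subset by blast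
  have "coeff p (nat (k + N)) = (\<Sum>l\<in>K. if l = k then a l else 0)"
    unfolding p_def coeff_sum
  proof (rule sum.cong[OF refl])
    fix l assume "l \<in> K"
    hence "nat (l + N) = nat (k + N) \<longleftrightarrow> l = k" using N k by (auto simp: nat_eq_iff)
    thus "coeff (monom (a l) (nat (l + N))) (nat (k + N)) = (if l = k then a l else 0)" by auto
  qed
  thus ?thesis using K k \<open>p = 0\<close> by simp
qed

text \<open>
  The pullback of the polynomial \<open>f\<close> along the map \<open>\<theta> t\<close>. Its expansion in powers of \<open>t\<close> has the
  weight components of \<open>f\<close> as coefficients.
\<close>

definition pull :: "(complex \<Rightarrow> plane_map) \<Rightarrow> plane_poly \<Rightarrow> complex \<Rightarrow> complex \<Rightarrow> complex \<Rightarrow> complex" where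
  "pull \<theta> f t x y = (case \<theta> t (x, y) of (x', y') \<Rightarrow> poly2 f x' y')"

definition expands :: "(complex \<Rightarrow> plane_map) \<Rightarrow> plane_poly \<Rightarrow> (int \<Rightarrow> plane_poly) \<Rightarrow> bool" where
  "expands \<theta> f g \<longleftrightarrow> finite {k. g k \<noteq> 0} \<and>
     (\<forall>t x y. t \<noteq> 0 \<longrightarrow> pull \<theta> f t x y = (\<Sum>k | g k \<noteq> 0. t powi k * poly2 (g k) x y))"

lemma expandsI:
  assumes "finite S" "\<And>k. k \<notin> S \<Longrightarrow> g k = 0"
    and "\<And>t x y. t \<noteq> 0 \<Longrightarrow> pull \<theta> f t x y = (\<Sum>k\<in>S. t powi k * poly2 (g k) x y)"
  shows "expands \<theta> f g"
proof -
  have sub: "{k. g k \<noteq> 0} \<subseteq> S" using assms(2) by blast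
  have "(\<Sum>k | g k \<noteq> 0. t powi k * poly2 (g k) x y) = (\<Sum>k\<in>S. t powi k * poly2 (g k) x y)" for t x y
    by (rule sum.mono_neutral_left) (use assms(1) sub in auto)
  thus ?thesis using assms(3) finite_subset[OF sub assms(1)] by (simp add: expands_def)
qed

lemma expands_superset:
  assumes "expands \<theta> f g" "finite S" "{k. g k \<noteq> 0} \<subseteq> S" "t \<noteq> 0"
  shows "pull \<theta> f t x y = (\<Sum>k\<in>S. t powi k * poly2 (g k) x y)"
proof -
  have "(\<Sum>k | g k \<noteq> 0. t powi k * poly2 (g k) x y) = (\<Sum>k\<in>S. t powi k * poly2 (g k) x y)"
    by (rule sum.mono_neutral_left) (use assms in auto)
  thus ?thesis using assms by (simp add: expands_def)
qed

lemma expands_unique: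
  assumes "expands \<theta> f g" "expands \<theta> f h"
  shows "g = h"
proof
  fix k
  define S where "S = insert k ({k. g k \<noteq> 0} \<union> {k. h k \<noteq> 0})"
  have S: "finite S" and sub: "{k. g k \<noteq> 0} \<subseteq> S" "{k. h k \<noteq> 0} \<subseteq> S"
    using assms by (auto simp: S_def expands_def)
  show "g k = h k"
  proof (rule poly2_eqI)
    fix x y
    have "(\<Sum>k\<in>S. t powi k * (poly2 (g k) x y - poly2 (h k) x y)) = 0" if "t \<noteq> 0" for t
      using expands_superset[OF assms(1) S sub(1) that, of x y]
        expands_superset[OF assms(2) S sub(2) that, of x y]
      by (simp add: right_diff_distrib sum_subtractf)
    from laurent_coeffs_zero[OF S this, of k]
    show "poly2 (g k) x y = poly2 (h k) x y" by (simp add: S_def)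
  qed
qed

lemma expands_add:
  assumes "expands \<theta> f g" "expands \<theta> f' g'"
  shows "expands \<theta> (f + f') (\<lambda>k. g k + g' k)"
proof (rule expandsI)
  let ?S = "{k. g k \<noteq> 0} \<union> {k. g' k \<noteq> 0}"
  show S: "finite ?S" using assms by (simp add: expands_def)
  fix t x y :: complex assume t: "t \<noteq> 0"
  have "pull \<theta> (f + f') t x y = pull \<theta> f t x y + pull \<theta> f' t x y"
    by (simp add: pull_def split: prod.split)
  thus "pull \<theta> (f + f') t x y = (\<Sum>k\<in>?S. t powi k * poly2 (g k + g' k) x y)"
    using expands_superset[OF assms(1) S _ t, of x y] expands_superset[OF assms(2) S _ t, of x y]
    by (simp add: distrib_left sum.distrib)
qed auto

lemma expands_mult:
  assumes "expands \<theta> f g" "expands \<theta> f' g'"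
  shows "\<exists>h. expands \<theta> (f * f') h"
proof -
  define I where "I = {k. g k \<noteq> 0} \<times> {k. g' k \<noteq> 0}"
  define h where "h m = (\<Sum>(k, l)\<in>{p \<in> I. fst p + snd p = m}. g k * g' l)" for m
  have I: "finite I" using assms by (simp add: I_def expands_def)
  have "expands \<theta> (f * f') h"
  proof (rule expandsI)
    let ?S = "(\<lambda>p. fst p + snd p) ` I"
    show "finite ?S" using I by simp
    show "h m = 0" if "m \<notin> ?S" for m
      unfolding h_def using that by (intro sum.neutral) force
    fix t x y :: complex assume t: "t \<noteq> 0"
    have "pull \<theta> (f * f') t x y = pull \<theta> f t x y * pull \<theta> f' t x y"
      by (simp add: pull_def split: prod.split)
    also have "\<dots> = (\<Sum>k | g k \<noteq> 0. t powi k * poly2 (g k) x y) *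
        (\<Sum>l | g' l \<noteq> 0. t powi l * poly2 (g' l) x y)"
      using assms t by (simp add: expands_def)
    also have "\<dots> = (\<Sum>p\<in>I. t powi (fst p + snd p) * poly2 (g (fst p) * g' (snd p)) x y)"
      unfolding sum_product I_def sum.cartesian_product
      by (intro sum.cong) (auto simp: t power_int_add)
    also have "\<dots> = (\<Sum>m\<in>?S. \<Sum>p\<in>{p \<in> I. fst p + snd p = m}.
        t powi (fst p + snd p) * poly2 (g (fst p) * g' (snd p)) x y)"
      by (rule sum.image_gen[OF I])
    also have "\<dots> = (\<Sum>m\<in>?S. t powi m * poly2 (h m) x y)"
      by (intro sum.cong refl) (simp add: h_def poly2_sum sum_distrib_left case_prod_unfold)
    finally show "pull \<theta> (f * f') t x y = (\<Sum>m\<in>?S. t powi m * poly2 (h m) x y)" .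
  qed
  thus ?thesis by blast
qed

lemma expands_homogeneous:
  assumes "\<And>t x y. t \<noteq> 0 \<Longrightarrow> pull \<theta> f t x y = t powi k * poly2 f x y"
  shows "expands \<theta> f (\<lambda>j. if j = k then f else 0)"
  by (rule expandsI[of "{k}"]) (use assms in auto)

lemma expands_cst: "expands \<theta> (cst z) (\<lambda>j. if j = 0 then cst z else 0)"
  by (rule expands_homogeneous) (simp add: pull_def split: prod.split)

lemma expands_coordinate:
  assumes "regular_Gm_plane r" "\<And>t x y. pull \<theta> f t x y = r t (x, y)"
  shows "\<exists>g. expands \<theta> f g"
proof -
  obtain K p where K: "finite (K :: int set)"
    and r: "\<And>t x y. t \<noteq> 0 \<Longrightarrow> r t (x, y) = (\<Sum>k\<in>K. t powi k * poly2 (p k) x y)"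
    using assms(1) unfolding regular_Gm_plane_def by metis
  have "expands \<theta> f (\<lambda>k. if k \<in> K then p k else 0)"
    by (rule expandsI[OF K]) (simp_all add: assms(2) r)
  thus ?thesis by blast
qed

context
  fixes \<theta>
  assumes act: "algebraic_action \<theta>"
begin

lemma ex_expands: "\<exists>g. expands \<theta> f g"
proof (induction f rule: plane_poly_induct)
  case X
  show ?case
    by (rule expands_coordinate[of "\<lambda>t z. fst (\<theta> t z)"])
      (use act in \<open>auto simp: algebraic_action_def pull_def split: prod.splits\<close>)
next
  case Y
  show ?case
    by (rule expands_coordinate[of "\<lambda>t z. snd (\<theta> t z)"])
      (use act in \<open>auto simp: algebraic_action_def pull_def split: prod.splits\<close>)
qed (use expands_cst expands_add expands_mult in blast)+

definition weight_component :: "int \<Rightarrow> plane_poly \<Rightarrow> plane_poly" where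
  "weight_component k f = (SOME g. expands \<theta> f g) k"

lemma expands_weight_component: "expands \<theta> f (\<lambda>k. weight_component k f)"
  unfolding weight_component_def using someI_ex[OF ex_expands] by simp

lemma weight_component_eqI: "expands \<theta> f g \<Longrightarrow> weight_component k f = g k"
  using expands_unique[OF expands_weight_component] by metis

text \<open>Compare the expansions of both sides of \<open>f (\<theta> (s * t) z) = f (\<theta> s (\<theta> t z))\<close> in powers of \<open>s\<close>.\<close>

lemma pull_weight_component:
  assumes t: "t \<noteq> 0"
  shows "pull \<theta> (weight_component k f) t x y = t powi k * poly2 (weight_component k f) x y"
proof -
  obtain x' y' where xy: "\<theta> t (x, y) = (x', y')" by force
  define S where "S = insert k {k. weight_component k f \<noteq> 0}"
  have S: "finite S" and sub: "{k. weight_component k f \<noteq> 0} \<subseteq> S"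
    using expands_weight_component[of f] by (auto simp: S_def expands_def)
  have "(\<Sum>k\<in>S. s powi k * (poly2 (weight_component k f) x' y' -
      t powi k * poly2 (weight_component k f) x y)) = 0" if s: "s \<noteq> 0" for s
  proof -
    have st: "s * t \<noteq> 0" using s t by simp
    have "\<theta> (s * t) (x, y) = \<theta> s (x', y')"
      using act s t xy by (simp add: algebraic_action_def)
    hence "pull \<theta> f (s * t) x y = pull \<theta> f s x' y'" by (simp add: pull_def)
    hence "(\<Sum>k\<in>S. (s * t) powi k * poly2 (weight_component k f) x y) =
        (\<Sum>k\<in>S. s powi k * poly2 (weight_component k f) x' y')"
      using expands_superset[OF expands_weight_component[of f] S sub st, of x y]
        expands_superset[OF expands_weight_component[of f] S sub s, of x' y']
      by simp
    thus ?thesis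
      by (simp add: right_diff_distrib sum_subtractf power_int_mult_distrib mult.assoc)
  qed
  from laurent_coeffs_zero[OF S this, of k] show ?thesis
    by (simp add: S_def pull_def xy)
qed

lemma weight_component_homogeneous:
  assumes "\<And>t x y. t \<noteq> 0 \<Longrightarrow> pull \<theta> f t x y = t powi k * poly2 f x y"
  shows "weight_component j f = (if j = k then f else 0)"
  by (rule weight_component_eqI[OF expands_homogeneous[OF assms]])

lemma plane_grading_weight_component: "plane_grading weight_component"
proof
  fix f g :: plane_poly and i j k :: int and z :: complex
  show "weight_component k (f + g) = weight_component k f + weight_component k g"
    by (rule weight_component_eqI[OF expands_add[OF expands_weight_component expands_weight_component]])
  show "finite {k. weight_component k f \<noteq> 0}"
    using expands_weight_component[of f] by (simp add: expands_def)
  show "(\<Sum>k | weight_component k f \<noteq> 0. weight_component k f) = f"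
  proof (rule poly2_eqI)
    fix x y
    have "pull \<theta> f 1 x y = (\<Sum>k | weight_component k f \<noteq> 0. poly2 (weight_component k f) x y)"
      using expands_weight_component[of f] unfolding expands_def by simp
    thus "poly2 (\<Sum>k | weight_component k f \<noteq> 0. weight_component k f) x y = poly2 f x y"
      using act by (simp add: poly2_sum pull_def algebraic_action_def)
  qed
  show "weight_component j (weight_component k f) = (if j = k then weight_component k f else 0)"
    by (rule weight_component_homogeneous[OF pull_weight_component])
  show "weight_component 0 (cst z) = cst z"
    by (subst weight_component_homogeneous[of _ 0]) (simp_all add: pull_def split: prod.split)
  show "weight_component (i + j) (f * g) = f * g"
    if "weight_component i f = f" "weight_component j g = g"
  proof (subst weight_component_homogeneous[of _ "i + j"])
    fix t x y :: complex assume t: "t \<noteq> 0"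
    have "pull \<theta> (f * g) t x y = pull \<theta> f t x y * pull \<theta> g t x y"
      by (simp add: pull_def split: prod.split)
    thus "pull \<theta> (f * g) t x y = t powi (i + j) * poly2 (f * g) x y"
      using pull_weight_component[OF t, of i f] pull_weight_component[OF t, of j g] that t
      by (simp add: power_int_add)
  qed simp
qed

end

lemma map_of_polys_comp:
  "map_of_polys P Q \<circ> map_of_polys f s = map_of_polys (subst P f s) (subst Q f s)"
  by (auto simp: map_of_polys_def)

lemma map_of_polys_X_Y: "map_of_polys X Y = id"
  by (auto simp: map_of_polys_def)

lemma poly_automorphismI:
  assumes "poly_map F" "poly_map G" "F \<circ> G = id" "G \<circ> F = id"
  shows "poly_automorphism F"
proof -
  have "bij F" using assms o_bij by blast
  moreover have "inv F = G" using assms(3,4) by (simp add: inv_unique_comp)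
  ultimately show ?thesis using assms by (simp add: poly_automorphism_def)
qed

text \<open>
  Homogeneous generators \<open>f\<close>, \<open>s\<close> of the polynomial ring are coordinates in which the action is
  diagonal. Expressing \<open>X\<close> and \<open>Y\<close> by them gives a left inverse of the map \<open>(f, s)\<close>; it is
  also a right inverse because \<open>f\<close> and \<open>s\<close> are algebraically independent.
\<close>

theorem torus_action_linearisable:
  assumes act: "algebraic_action \<theta>"
  shows "\<exists>\<phi> a b. poly_automorphism \<phi> \<and>
    (\<forall>t. t \<noteq> 0 \<longrightarrow> diagonal_action a b t = \<phi> \<circ> \<theta> t \<circ> inv \<phi>)"
proof -
  interpret plane_grading "weight_component \<theta>"
    by (rule plane_grading_weight_component[OF act])
  obtain f s a b where fs: "hom a f" "hom b s"
      and gen: "\<And>g. \<exists>R. g = subst R f s" and indep: "\<And>R. subst R f s = 0 \<Longrightarrow> R = 0"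
    using homogeneous_coordinates by metis
  obtain P Q where PQ: "X = subst P f s" "Y = subst Q f s" using gen by metis
  have "poly2 P (poly2 f x y) (poly2 s x y) = x" "poly2 Q (poly2 f x y) (poly2 s x y) = y" for x y
    using arg_cong[OF PQ(1), of "\<lambda>R. poly2 R x y"] arg_cong[OF PQ(2), of "\<lambda>R. poly2 R x y"]
    by simp_all
  hence "subst (subst f P Q - X) f s = 0" "subst (subst s P Q - Y) f s = 0"
    by (intro poly2_eqI, simp)+
  hence "subst f P Q = X" "subst s P Q = Y" using indep by fastforce+
  hence inverse: "map_of_polys P Q \<circ> map_of_polys f s = id" "map_of_polys f s \<circ> map_of_polys P Q = id"
    using PQ by (simp_all add: map_of_polys_comp map_of_polys_X_Y)
  define \<phi> where "\<phi> = map_of_polys f s"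
  have \<phi>: "poly_automorphism \<phi>"
    by (rule poly_automorphismI[of _ "map_of_polys P Q"])
      (use inverse in \<open>auto simp: \<phi>_def poly_map_def\<close>)
  have "diagonal_action a b t = \<phi> \<circ> \<theta> t \<circ> inv \<phi>" if t: "t \<noteq> 0" for t
  proof
    fix z
    obtain x y where xy: "inv \<phi> z = (x, y)" by force
    have "z = \<phi> (x, y)" using \<phi> xy by (metis bij_inv_eq_iff poly_automorphism_def)
    moreover have "\<phi> (\<theta> t (x, y)) = diagonal_action a b t (\<phi> (x, y))"
      using pull_weight_component[OF act t, of a f x y] pull_weight_component[OF act t, of b s x y] fs
      by (auto simp: \<phi>_def map_of_polys_def diagonal_action_def hom_def pull_def split: prod.splits)
    ultimately show "diagonal_action a b t z = (\<phi> \<circ> \<theta> t \<circ> inv \<phi>) z" using xy by simp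
  qed
  thus ?thesis using \<phi> by blast
qed

section \<open>Automorphisms and Keller maps\<close>

lemma poly_map_comp: "poly_map F \<Longrightarrow> poly_map G \<Longrightarrow> poly_map (F \<circ> G)"
  unfolding poly_map_def using map_of_polys_comp by metis

lemma poly_automorphism_inv:
  assumes "poly_automorphism F"
  shows "poly_automorphism (inv F)"
  using assms by (auto simp: poly_automorphism_def bij_imp_bij_inv inv_inv_eq)

lemma poly_automorphism_inv_comp:
  assumes "poly_automorphism F"
  shows "inv F \<circ> F = id" "F \<circ> inv F = id"
  using assms by (simp_all add: poly_automorphism_def bij_is_inj surj_iff[THEN iffD1] bij_is_surj)

lemma poly_automorphism_comp:
  assumes "poly_automorphism F" "poly_automorphism G"
  shows "poly_automorphism (F \<circ> G)"
  using assms by (auto simp: poly_automorphism_def bij_comp o_inv_distrib intro: poly_map_comp)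

lemma keller_map_comp:
  assumes "keller_map F" "keller_map G"
  shows "keller_map (F \<circ> G)"
proof -
  obtain P Q c where F: "F = map_of_polys P Q" "c \<noteq> 0" "jacobian_det P Q = cst c"
    using assms(1) by (auto simp: keller_map_def cst_def)
  obtain f s e where G: "G = map_of_polys f s" "e \<noteq> 0" "jacobian_det f s = cst e"
    using assms(2) by (auto simp: keller_map_def cst_def)
  have "jacobian_det (subst P f s) (subst Q f s) = cst (c * e)"
    by (simp add: jacobian_subst F G)
  thus ?thesis unfolding keller_map_def
    using F G map_of_polys_comp[of P Q f s] by (metis cst_def no_zero_divisors)
qed

text \<open>By the chain rule the Jacobian determinant of an automorphism is a unit.\<close>

lemma keller_map_automorphism:
  assumes "poly_automorphism F"
  shows "keller_map F"
proof -
  obtain f s where F: "F = map_of_polys f s"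
    using assms by (auto simp: poly_automorphism_def poly_map_def)
  obtain P Q where G: "inv F = map_of_polys P Q"
    using assms by (auto simp: poly_automorphism_def poly_map_def)
  have "map_of_polys P Q \<circ> F = id"
    using poly_automorphism_inv_comp(1)[OF assms] by (simp only: G)
  hence "map_of_polys (subst P f s) (subst Q f s) = id"
    by (simp only: F map_of_polys_comp)
  hence "(poly2 (subst P f s) x y, poly2 (subst Q f s) x y) = (x, y)" for x y
    by (metis (no_types, lifting) case_prod_conv id_apply map_of_polys_def)
  hence "subst P f s = X" "subst Q f s = Y" by (auto intro!: poly2_eqI)
  hence "subst (jacobian_det P Q) f s * jacobian_det f s = 1"
    unfolding jacobian_subst[symmetric] by (simp add: jacobian_det_def)
  hence "jacobian_det f s dvd 1" by (metis dvd_triv_right)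
  then obtain c where "jacobian_det f s = [:[:c:]:]" "c \<noteq> 0"
    by (auto simp: unit_iff_cst cst_def)
  thus ?thesis using F unfolding keller_map_def by blast
qed

definition swap :: plane_map where
  "swap = (\<lambda>(x, y). (y, x))"

lemma swap_swap: "swap \<circ> swap = id" by (auto simp: swap_def)

lemma poly_automorphism_swap: "poly_automorphism swap"
proof (rule poly_automorphismI)
  have "swap = map_of_polys Y X" by (auto simp: swap_def map_of_polys_def)
  thus "poly_map swap" by (auto simp: poly_map_def)
  thus "poly_map swap" .
qed (rule swap_swap)+

lemma swap_diagonal_action: "swap \<circ> diagonal_action a b t = diagonal_action b a t \<circ> swap"
  by (auto simp: swap_def diagonal_action_def)

lemma triangular_automorphism:
  assumes "a \<noteq> 0" "b \<noteq> 0"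
  shows "poly_automorphism (map_of_polys (cst a * X + cst e) (cst b * Y + [:p:]))"
proof -
  define P where "P = cst (1 / a) * (X - cst e)"
  define Q where "Q = cst (1 / b) * (Y - ev p P)"
  have P: "poly2 P x y = (x - e) / a" and Q: "poly2 Q x y = (y - poly p ((x - e) / a)) / b" for x y
    by (simp_all add: Q_def P_def)
  show ?thesis
  proof (rule poly_automorphismI[of _ "map_of_polys P Q"])
    have "a * ((x - e) / a) + e = x" "b * ((y - r) / b) + r = y" for x y r
      using assms by simp_all
    thus "map_of_polys (cst a * X + cst e) (cst b * Y + [:p:]) \<circ> map_of_polys P Q = id"
      unfolding map_of_polys_def comp_def case_prod_unfold fst_conv snd_conv P Q poly2_simps poly2_pCons
      by (simp add: id_def)
    have "(a * x + e - e) / a = x" "(b * y + r - r) / b = y" for x y r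
      using assms by simp_all
    thus "map_of_polys P Q \<circ> map_of_polys (cst a * X + cst e) (cst b * Y + [:p:]) = id"
      unfolding map_of_polys_def comp_def case_prod_unfold fst_conv snd_conv P Q poly2_simps poly2_pCons
      by (simp add: id_def)
  qed (auto simp: poly_map_def)
qed

text \<open>Gaussian elimination: a product of an upper and a lower triangular matrix.\<close>

lemma linear_automorphism:
  assumes "a * e - b * c \<noteq> 0" "a \<noteq> 0"
  shows "poly_automorphism (map_of_polys (cst a * X + cst b * Y) (cst c * X + cst e * Y))"
proof -
  define A where "A = map_of_polys (cst 1 * X + cst 0) (cst (e - b * c / a) * Y + [:[:0, c / a:]:])"
  define B where "B = map_of_polys (cst 1 * X + cst 0) (cst a * Y + [:[:0, b:]:])"
  have "e - b * c / a \<noteq> 0" using assms by (simp add: field_simps)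
  hence "poly_automorphism (A \<circ> (swap \<circ> B \<circ> swap))"
    unfolding A_def B_def using assms
    by (intro poly_automorphism_comp triangular_automorphism poly_automorphism_swap) auto
  moreover have "map_of_polys (cst a * X + cst b * Y) (cst c * X + cst e * Y) = A \<circ> (swap \<circ> B \<circ> swap)"
  proof
    fix z :: "complex \<times> complex"
    obtain x y where z: "z = (x, y)" by force
    define q where "q = c / a"
    have c: "c = q * a" using assms(2) by (simp add: q_def)
    have "b * c / a = b * q" by (simp add: q_def)
    thus "map_of_polys (cst a * X + cst b * Y) (cst c * X + cst e * Y) z = (A \<circ> (swap \<circ> B \<circ> swap)) z"
      unfolding z A_def B_def swap_def map_of_polys_def comp_def prod.case poly2_simps poly2_pCons q_def[symmetric]
      by (simp add: c algebra_simps)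
  qed
  ultimately show ?thesis by simp
qed

section \<open>Equivariant Keller maps for diagonal actions\<close>

lemma coeff_subst_scaling:
  "coeff (subst P (cst \<alpha> * X) (cst \<beta> * Y)) j = smult (\<beta> ^ j) (pcompose (coeff P j) [:0, \<alpha>:])"
proof (induction P arbitrary: j)
  case (pCons p P)
  have ev: "ev p (cst \<alpha> * X) = [:pcompose p [:0, \<alpha>:]:]"
    by (rule poly2_eqI) (simp add: poly_pcompose mult.commute)
  have "cst \<beta> * Y * R = pCons 0 (smult [:\<beta>:] R)" for R
    by (simp add: cst_def Y_def)
  thus ?case by (cases j) (simp_all add: ev pCons.IH mult.commute[of \<beta>])
qed simp

lemma two_powi_inject: "2 powi m = (2 powi n :: complex) \<Longrightarrow> m = n"
proof -
  assume "2 powi m = (2 powi n :: complex)"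
  hence "norm (2 powi m :: complex) = norm (2 powi n :: complex)" by simp
  hence "(2 :: real) powi m = 2 powi n" by (simp add: norm_power_int)
  moreover have "(2 :: real) powi i < 2 powi j" if "i < j" for i j
    using that by (intro power_int_strict_increasing) auto
  ultimately show "m = n" by (metis linorder_neqE less_irrefl)
qed

text \<open>
  Compare coefficients at \<open>t = 2\<close>, which is not a root of unity, so that the power of \<open>t\<close>
  determines the exponent.
\<close>

lemma weights_of_monomials:
  assumes "\<And>t x y. t \<noteq> 0 \<Longrightarrow> poly2 P (t powi w1 * x) (t powi w2 * y) = t powi v * poly2 P x y"
    and "coeff (coeff P j) i \<noteq> 0"
  shows "int i * w1 + int j * w2 = v"
proof -
  define \<alpha> \<beta> \<gamma> :: complex where "\<alpha> = 2 powi w1" and "\<beta> = 2 powi w2" and "\<gamma> = 2 powi v"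
  have "subst P (cst \<alpha> * X) (cst \<beta> * Y) = cst \<gamma> * P"
    by (rule poly2_eqI) (use assms(1)[of 2] in \<open>simp add: \<alpha>_def \<beta>_def \<gamma>_def\<close>)
  hence "coeff (coeff (subst P (cst \<alpha> * X) (cst \<beta> * Y)) j) i = \<gamma> * coeff (coeff P j) i"
    by (simp add: cst_def)
  hence "\<beta> ^ j * \<alpha> ^ i = \<gamma>"
    using assms(2) unfolding coeff_subst_scaling by (simp add: coeff_pcompose_linear)
  hence "2 powi (int j * w2 + int i * w1) = (2 powi v :: complex)"
    by (simp add: \<alpha>_def \<beta>_def \<gamma>_def power_int_add power_int_mult power_int_power mult.commute)
  thus ?thesis using two_powi_inject by fastforce
qed

lemma plane_poly_eqI:
  "(\<And>i j. coeff (coeff P j) i = coeff (coeff Q j) i) \<Longrightarrow> P = (Q :: plane_poly)"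
  by (intro poly_eqI)

lemma cst_times_X_Y: "cst a * X = [:[:0, a:]:]" "cst a * Y = [:0, [:a:]:]"
  by (simp_all add: cst_def X_def Y_def)

lemma coeff_mult_top:
  fixes p q :: "'a :: comm_ring_1 poly"
  assumes "degree p \<le> m" "degree q \<le> n"
  shows "coeff (p * q) (m + n) = coeff p m * coeff q n"
proof -
  have "coeff (p * q) (m + n) = (\<Sum>i\<in>{m}. coeff p i * coeff q (m + n - i))"
    unfolding coeff_mult
  proof (rule sum.mono_neutral_right)
    show "\<forall>i\<in>{..m + n} - {m}. coeff p i * coeff q (m + n - i) = 0"
    proof
      fix i assume "i \<in> {..m + n} - {m}"
      hence "i > m \<or> m + n - i > n" by auto
      thus "coeff p i * coeff q (m + n - i) = 0" using assms by (auto simp: coeff_eq_0)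
    qed
  qed auto
  thus ?thesis by simp
qed

text \<open>
  For weights of opposite signs, each coefficient of a power of \<open>y\<close> is a single monomial in \<open>x\<close>; let
  \<open>\<alpha> x\<^sup>i y\<^sup>j\<close> and \<open>\<beta> x\<^sup>k y\<^sup>l\<close> be the terms of highest \<open>y\<close>-degree. The Jacobian determinant
  contains \<open>(i l - j k) \<alpha> \<beta> x\<^sup>i\<^sup>+\<^sup>k\<^sup>-\<^sup>1 y\<^sup>j\<^sup>+\<^sup>l\<^sup>-\<^sup>1\<close>, and the weights force the integer factor to be
  nonzero. If the determinant is constant, this term must have exponent \<open>j + l - 1 = 0\<close>.
\<close>

lemma hyperbolic_leading_terms:
  assumes P: "\<And>i j. coeff (coeff P j) i \<noteq> 0 \<Longrightarrow> int i * w1 + int j * w2 = w1"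
    and Q: "\<And>i j. coeff (coeff Q j) i \<noteq> 0 \<Longrightarrow> int i * w1 + int j * w2 = w2"
    and w: "w1 * w2 < 0"
    and jac: "jacobian_det P Q = cst c"
    and nz: "P \<noteq> 0" "degree Q > 0"
  shows "degree P = 0 \<and> degree Q = 1"
proof -
  define j l where "j = degree P" and "l = degree Q"
  define p q where "p = lead_coeff P" and "q = lead_coeff Q"
  have "p \<noteq> 0" "q \<noteq> 0" using nz by (auto simp: p_def q_def)
  have "w1 \<noteq> 0" using w by auto
  obtain i where i: "coeff p i \<noteq> 0" using \<open>p \<noteq> 0\<close> by (metis leading_coeff_0_iff)
  obtain k where k: "coeff q k \<noteq> 0" using \<open>q \<noteq> 0\<close> by (metis leading_coeff_0_iff)
  define \<alpha> \<beta> where "\<alpha> = coeff p i" and "\<beta> = coeff q k"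
  have wi: "int i * w1 + int j * w2 = w1" using P[of j i] i by (simp add: p_def j_def)
  have wk: "int k * w1 + int l * w2 = w2" using Q[of l k] k by (simp add: q_def l_def)
  have "coeff p i' = 0" if "i' \<noteq> i" for i'
  proof (rule ccontr)
    assume "coeff p i' \<noteq> 0"
    hence "int i' * w1 + int j * w2 = w1" using P[of j i'] by (simp add: p_def j_def)
    hence "int i' * w1 = int i * w1" using wi by linarith
    thus False using that \<open>w1 \<noteq> 0\<close> by simp
  qed
  hence p: "p = monom \<alpha> i" by (intro poly_eqI) (auto simp: \<alpha>_def)
  have "coeff q k' = 0" if "k' \<noteq> k" for k'
  proof (rule ccontr)
    assume "coeff q k' \<noteq> 0"
    hence "int k' * w1 + int l * w2 = w2" using Q[of l k'] by (simp add: q_def l_def)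
    hence "int k' * w1 = int k * w1" using wk by linarith
    thus False using that \<open>w1 \<noteq> 0\<close> by simp
  qed
  hence q: "q = monom \<beta> k" by (intro poly_eqI) (auto simp: \<beta>_def)
  define x where "x = [:0, 1 :: complex:]"
  have x_monom: "x * pderiv (monom a n) = monom (of_nat n * a) n" for a n
    by (rule poly_eqI) (simp add: x_def coeff_pCons coeff_pderiv split: nat.splits)
  \<comment> \<open>Multiplying by \<open>Y\<close> and \<open>x\<close> avoids the exponents lowered by \<open>1\<close>.\<close>
  have coeffs: "coeff (dx R) n = pderiv (coeff R n)" "coeff (Y * dy R) n = of_nat n * coeff R n" for R n
    by (auto simp: dx_def dy_def coeff_map_poly Y_def coeff_pCons coeff_pderiv split: nat.splits)
  have "degree (dx P) \<le> j" "degree (dx Q) \<le> l" "degree (Y * dy P) \<le> j" "degree (Y * dy Q) \<le> l"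
    by (rule degree_le; simp add: coeffs j_def l_def coeff_eq_0)+
  note top = coeff_mult_top[OF this(1,4)] coeff_mult_top[OF this(3,2)]
  have "dx P * (Y * dy Q) - (Y * dy P) * dx Q = cst c * Y"
    using jac by (simp add: jacobian_det_def algebra_simps)
  hence "coeff (cst c * Y) (j + l) = pderiv p * (of_nat l * q) - (of_nat j * p) * pderiv q"
    by (metis coeff_diff top coeffs p_def q_def j_def l_def)
  hence "x * coeff (cst c * Y) (j + l) =
      x * (pderiv p * (of_nat l * q) - (of_nat j * p) * pderiv q)" by (simp only:)
  also have "\<dots> = of_nat l * ((x * pderiv p) * q) - of_nat j * (p * (x * pderiv q))"
    by (simp add: algebra_simps)
  also have "\<dots> = monom (of_int (int i * int l - int j * int k) * (\<alpha> * \<beta>)) (i + k)"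
  proof -
    have xp: "x * pderiv p = monom (of_nat i * \<alpha>) i" and xq: "x * pderiv q = monom (of_nat k * \<beta>) k"
      unfolding p q by (rule x_monom)+
    show ?thesis
      unfolding xp xq unfolding p q
      by (simp add: mult_monom of_nat_poly smult_monom diff_monom algebra_simps)
  qed
  finally have eq: "x * coeff (cst c * Y) (j + l) = \<dots>" .
  have "int i * int l - int j * int k \<noteq> 0"
  proof
    assume "int i * int l - int j * int k = 0"
    hence "(int i * int l - int j * int k) * w1 = 0" by simp
    moreover have "(int i * int l - int j * int k) * w1 =
        int l * (int i * w1 + int j * w2) - int j * (int k * w1 + int l * w2)"
      by (simp add: algebra_simps)
    ultimately have eq: "int l * w1 = int j * w2" using wi wk by simp
    have "int l > 0" using nz by (simp add: l_def)
    hence "int l * (w1 * w1) > 0" using \<open>w1 \<noteq> 0\<close> by (auto simp: zero_less_mult_iff)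
    moreover have "int l * (w1 * w1) = int j * (w1 * w2)"
      using arg_cong[OF eq, of "\<lambda>z. z * w1"] by (simp only: mult_ac)
    moreover have "int j * (w1 * w2) \<le> 0" by (rule mult_nonneg_nonpos) (use w in auto)
    ultimately show False by linarith
  qed
  hence "monom (of_int (int i * int l - int j * int k) * (\<alpha> * \<beta>)) (i + k) \<noteq> 0"
    using i k by (simp only: monom_eq_0_iff mult_eq_0_iff of_int_eq_0_iff \<alpha>_def \<beta>_def) simp
  hence "coeff (cst c * Y) (j + l) \<noteq> 0" using eq by auto
  hence "j + l = 1" by (auto simp: cst_times_X_Y coeff_pCons split: nat.splits)
  thus ?thesis using nz by (simp add: j_def l_def)
qed

lemma positive_weight_solutions:
  fixes a b :: int
  assumes "0 < a" "a \<le> b"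
  shows "int i * a + int j * b = a \<Longrightarrow> j = 0 \<and> i = 1 \<or> i = 0 \<and> j = 1 \<and> a = b"
    and "int i * a + int j * b = b \<Longrightarrow> j = 0 \<or> i = 0 \<and> j = 1"
proof -
  have ia: "int i * a \<ge> 0" "i \<ge> 1 \<Longrightarrow> int i * a \<ge> a" using assms by auto
  have jb: "int j * b \<ge> 0" "j \<ge> 1 \<Longrightarrow> int j * b \<ge> b" "j \<ge> 2 \<Longrightarrow> int j * b \<ge> 2 * b"
    using assms by (auto intro: mult_right_mono)
  show "j = 0 \<and> i = 1 \<or> i = 0 \<and> j = 1 \<and> a = b" if "int i * a + int j * b = a"
  proof (cases "j = 0")
    case True
    thus ?thesis using that assms by simp
  next
    case False
    hence "i = 0" "a = b" using that assms ia jb by (cases "i = 0"; linarith)+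
    thus ?thesis using that assms by simp
  qed
  show "j = 0 \<or> i = 0 \<and> j = 1" if "int i * a + int j * b = b"
  proof (cases "j = 0 \<or> j = 1")
    case True
    thus ?thesis using that assms by auto
  next
    case False
    hence "j \<ge> 2" by simp
    thus ?thesis using that assms ia jb by linarith
  qed
qed

text \<open>
  The monomials allowed by the weights are few: in the parabolic case the map is
  \<open>(p x, q x * y)\<close> with \<open>p' q\<close> constant, in the elliptic case it is triangular or linear, and
  in the hyperbolic case the bound on the degrees in \<open>y\<close> leaves only a diagonal map. The condition
  \<open>\<bar>w1\<bar> \<le> \<bar>w2\<bar>\<close> selects one of two mirror images.
\<close>

lemma weighted_keller_automorphism:
  assumes P: "\<And>i j. coeff (coeff P j) i \<noteq> 0 \<Longrightarrow> int i * w1 + int j * w2 = w1"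
    and Q: "\<And>i j. coeff (coeff Q j) i \<noteq> 0 \<Longrightarrow> int i * w1 + int j * w2 = w2"
    and jac: "jacobian_det P Q = cst c" "c \<noteq> 0"
    and lin: "coeff (coeff P 0) 1 \<noteq> 0" "coeff (coeff Q 1) 0 \<noteq> 0"
    and w: "w2 \<noteq> 0" "\<bar>w1\<bar> \<le> \<bar>w2\<bar>"
  shows "poly_automorphism (map_of_polys P Q)"
proof -
  define a b where "a = coeff (coeff P 0) 1" and "b = coeff (coeff Q 1) 0"
  have ab: "a \<noteq> 0" "b \<noteq> 0" using lin by (simp_all add: a_def b_def)
  consider "w1 = 0" | "w1 = w2" | "w1 \<noteq> w2" "w1 * w2 > 0" | "w1 * w2 < 0"
    using w by (metis linorder_neqE mult_eq_0_iff)
  thus ?thesis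
  proof cases
    case 1
    define p q where "p = coeff P 0" and "q = coeff Q 1"
    have "P = [:p:]"
      by (rule plane_poly_eqI) (use P 1 w in \<open>force simp: p_def coeff_pCons split: nat.splits\<close>)
    moreover have "Q = [:0, q:]"
      by (rule plane_poly_eqI) (use Q 1 w in \<open>force simp: q_def coeff_pCons split: nat.splits\<close>)
    ultimately have "pderiv p * q = [:c:]"
      using jac by (simp add: jacobian_det_def dx_pCons dy_def pderiv_pCons cst_def mult.commute
          derivationD[OF derivation_dx])
    hence "degree (pderiv p) + degree q = 0"
      using jac by (metis degree_mult_eq degree_pCons_0 mult_eq_0_iff pCons_eq_0_iff)
    hence deg: "degree p \<le> 1" "degree q = 0" by (auto simp: degree_pderiv)
    define e where "e = coeff p 0"
    have "p = [:e, a:]"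
      by (rule poly_eqI) (use deg in \<open>auto simp: e_def a_def p_def coeff_pCons coeff_eq_0 split: nat.splits\<close>)
    moreover have "q = [:b:]"
      by (rule poly_eqI) (use deg in \<open>auto simp: b_def q_def coeff_pCons coeff_eq_0 split: nat.splits\<close>)
    ultimately have "P = cst a * X + cst e" "Q = cst b * Y + [:0:]"
      using \<open>P = [:p:]\<close> \<open>Q = [:0, q:]\<close> by (simp_all add: cst_times_X_Y, simp_all add: cst_def)
    thus ?thesis using triangular_automorphism[OF ab] by (simp only:)
  next
    case 2
    have sum: "i + j = 1" if "int i * w2 + int j * w2 = w2" for i j
    proof -
      have "(int i + int j) * w2 = 1 * w2" using that by (simp add: algebra_simps)
      thus ?thesis using w by (simp only: mult_cancel_right) auto
    qed
    define b' c' where "b' = coeff (coeff P 1) 0" and "c' = coeff (coeff Q 0) 1"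
    have "coeff (coeff P j) i = coeff (coeff (cst a * X + cst b' * Y) j) i" for i j
      using P[of j i] sum[of i j] 2
      by (cases "i + j = 1")
        (auto simp: cst_times_X_Y a_def b'_def coeff_pCons add_is_1 split: nat.splits)
    hence PP: "P = cst a * X + cst b' * Y" by (rule plane_poly_eqI)
    have "coeff (coeff Q j) i = coeff (coeff (cst c' * X + cst b * Y) j) i" for i j
      using Q[of j i] sum[of i j] 2
      by (cases "i + j = 1")
        (auto simp: cst_times_X_Y b_def c'_def coeff_pCons add_is_1 split: nat.splits)
    hence QQ: "Q = cst c' * X + cst b * Y" by (rule plane_poly_eqI)
    have "jacobian_det P Q = cst (a * b - b' * c')"
      unfolding PP QQ jacobian_det_def
      by (simp add: derivationD[OF derivation_dx] derivationD[OF derivation_dy])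
    hence "a * b - b' * c' \<noteq> 0" using jac by (simp del: cst_simps(4) add: cst_def)
    thus ?thesis unfolding PP QQ using linear_automorphism ab by blast
  next
    case 3
    have sol: "(int i * w1 + int j * w2 = w1 \<longrightarrow> j = 0 \<and> i = 1) \<and>
        (int i * w1 + int j * w2 = w2 \<longrightarrow> j = 0 \<or> i = 0 \<and> j = 1)" for i j
    proof (cases "w1 > 0")
      case True
      hence "0 < w1" "w1 \<le> w2" using 3 w by (auto simp: zero_less_mult_iff)
      thus ?thesis using positive_weight_solutions[of w1 w2 i j] 3 by blast
    next
      case False
      hence "0 < - w1" "- w1 \<le> - w2" using 3 w by (auto simp: zero_less_mult_iff)
      moreover have "int i * - w1 + int j * - w2 = - (int i * w1 + int j * w2)" by simp
      ultimately show ?thesis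
        using positive_weight_solutions[of "- w1" "- w2" i j] 3 by (metis neg_equal_iff_equal)
    qed
    have "coeff (coeff P j) i = 0" if "\<not> (j = 0 \<and> i = 1)" for i j
      using P[of j i] sol[of i j] that by blast
    hence "coeff (coeff P j) i = coeff (coeff (cst a * X + cst 0) j) i" for i j
      by (cases "j = 0 \<and> i = 1") (auto simp: cst_times_X_Y a_def coeff_pCons split: nat.splits)
    hence PP: "P = cst a * X + cst 0" by (rule plane_poly_eqI)
    have "coeff (coeff Q j) i = 0" if "j \<noteq> 0" "\<not> (j = 1 \<and> i = 0)" for i j
      using Q[of j i] sol[of i j] that by blast
    hence "coeff (coeff Q j) i = coeff (coeff (cst b * Y + [:coeff Q 0:]) j) i" for i j
      by (cases "j = 0 \<or> j = 1 \<and> i = 0")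
        (auto simp: cst_times_X_Y b_def coeff_pCons split: nat.splits)
    hence QQ: "Q = cst b * Y + [:coeff Q 0:]" by (rule plane_poly_eqI)
    show ?thesis
      using triangular_automorphism[OF ab, of 0 "coeff Q 0"] by (simp only: PP[symmetric] QQ[symmetric])
  next
    case 4
    have "coeff Q 1 \<noteq> 0" "P \<noteq> 0" using lin by auto
    hence "degree Q > 0" using le_degree[of Q 1] by simp
    hence deg: "degree P = 0" "degree Q = 1"
      using hyperbolic_leading_terms[OF P Q 4 jac(1) \<open>P \<noteq> 0\<close>] by auto
    have "w1 \<noteq> 0" using 4 by auto
    have no: "int i * w1 \<noteq> w2" for i
    proof
      assume "int i * w1 = w2"
      hence "w1 * w2 = int i * (w1 * w1)" by auto
      also have "\<dots> \<ge> 0" by simp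
      finally show False using 4 by simp
    qed
    have "coeff (coeff P j) i = 0" if "\<not> (j = 0 \<and> i = 1)" for i j
    proof (cases "j = 0")
      case True
      thus ?thesis using P[of 0 i] that \<open>w1 \<noteq> 0\<close> by fastforce
    qed (use deg in \<open>simp add: coeff_eq_0\<close>)
    hence "coeff (coeff P j) i = coeff (coeff (cst a * X + cst 0) j) i" for i j
      by (cases "j = 0 \<and> i = 1") (auto simp: cst_times_X_Y a_def coeff_pCons split: nat.splits)
    hence PP: "P = cst a * X + cst 0" by (rule plane_poly_eqI)
    have "coeff (coeff Q j) i = 0" if "\<not> (j = 1 \<and> i = 0)" for i j
    proof -
      consider "j = 0" | "j = 1" | "j > 1" by linarith
      thus ?thesis
      proof cases
        case 1
        thus ?thesis using Q[of 0 i] no[of i] by fastforce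
      next
        case 2
        thus ?thesis using Q[of 1 i] that \<open>w1 \<noteq> 0\<close> by fastforce
      qed (use deg in \<open>simp add: coeff_eq_0\<close>)
    qed
    hence "coeff (coeff Q j) i = coeff (coeff (cst b * Y + [:0:]) j) i" for i j
      by (cases "j = 1 \<and> i = 0") (auto simp: cst_times_X_Y b_def coeff_pCons split: nat.splits)
    hence QQ: "Q = cst b * Y + [:0:]" by (rule plane_poly_eqI)
    show ?thesis
      using triangular_automorphism[OF ab, of 0 0] by (simp only: PP[symmetric] QQ[symmetric])
  qed
qed

text \<open>
  Since the linear part at the origin is invertible, the two components contain the monomials
  \<open>x\<close> and \<open>y\<close>, in this or in the opposite order. This fixes the target weights, and in the second
  case the target coordinates are exchanged.
\<close>

lemma equivariant_keller_automorphism_ordered: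
  assumes F: "keller_map F" and w: "w2 \<noteq> 0" "\<bar>w1\<bar> \<le> \<bar>w2\<bar>"
    and eq: "\<And>t. t \<noteq> 0 \<Longrightarrow> F \<circ> diagonal_action w1 w2 t = diagonal_action v1 v2 t \<circ> F"
  shows "poly_automorphism F"
proof -
  obtain P Q c where PQ: "F = map_of_polys P Q" "c \<noteq> 0" "jacobian_det P Q = cst c"
    using F by (auto simp: keller_map_def cst_def)
  have "F (diagonal_action w1 w2 t (x, y)) = diagonal_action v1 v2 t (F (x, y))" if "t \<noteq> 0" for t x y
    using eq[OF that] by (metis comp_apply)
  hence wt: "poly2 P (t powi w1 * x) (t powi w2 * y) = t powi v1 * poly2 P x y"
    "poly2 Q (t powi w1 * x) (t powi w2 * y) = t powi v2 * poly2 Q x y" if "t \<noteq> 0" for t x y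
    using that by (simp_all add: PQ(1) map_of_polys_def diagonal_action_def)
  note P = weights_of_monomials[of P w1 w2 v1, OF wt(1)]
  note Q = weights_of_monomials[of Q w1 w2 v2, OF wt(2)]
  have at_0: "poly2 (dx R) 0 0 = coeff (coeff R 0) 1" "poly2 (dy R) 0 0 = coeff (coeff R 1) 0" for R
    by (simp_all add: poly2_def dx_def dy_def coeff_map_poly coeff_pderiv flip: poly_0_coeff_0)
       (simp_all add: poly_0_coeff_0 coeff_map_poly coeff_pderiv)
  have "coeff (coeff P 0) 1 * coeff (coeff Q 1) 0 - coeff (coeff P 1) 0 * coeff (coeff Q 0) 1 = c"
    using arg_cong[OF PQ(3), of "\<lambda>R. poly2 R 0 0"] by (simp add: jacobian_det_def at_0)
  then consider "coeff (coeff P 0) 1 \<noteq> 0" "coeff (coeff Q 1) 0 \<noteq> 0" |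
    "coeff (coeff P 1) 0 \<noteq> 0" "coeff (coeff Q 0) 1 \<noteq> 0" using PQ(2) by fastforce
  thus ?thesis
  proof cases
    case 1
    have "v1 = w1" "v2 = w2" using P[of 0 1] Q[of 1 0] 1 by auto
    thus ?thesis unfolding PQ(1)
      using weighted_keller_automorphism[of P w1 w2 Q c] P Q PQ(2,3) 1 w by blast
  next
    case 2
    have "v1 = w2" "v2 = w1" using P[of 1 0] Q[of 0 1] 2 by auto
    moreover have "jacobian_det Q P = cst (- c)" using PQ(3) by (simp add: jacobian_det_def algebra_simps)
    ultimately have "poly_automorphism (map_of_polys Q P)"
      using weighted_keller_automorphism[of Q w1 w2 P "- c"] P Q PQ(2) 2 w by simp
    moreover have "F = swap \<circ> map_of_polys Q P" by (auto simp: PQ(1) swap_def map_of_polys_def)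
    ultimately show ?thesis using poly_automorphism_comp poly_automorphism_swap by simp
  qed
qed

lemma equivariant_keller_automorphism:
  assumes F: "keller_map F" and w: "w1 \<noteq> 0 \<or> w2 \<noteq> 0"
    and eq: "\<And>t. t \<noteq> 0 \<Longrightarrow> F \<circ> diagonal_action w1 w2 t = diagonal_action v1 v2 t \<circ> F"
  shows "poly_automorphism F"
proof (cases "\<bar>w1\<bar> \<le> \<bar>w2\<bar>")
  case True
  thus ?thesis using equivariant_keller_automorphism_ordered[OF F _ _ eq] w by auto
next
  case False
  have "(F \<circ> swap) \<circ> diagonal_action w2 w1 t = diagonal_action v1 v2 t \<circ> (F \<circ> swap)" if "t \<noteq> 0" for t
    using eq[OF that] by (metis comp_assoc swap_diagonal_action)
  hence "poly_automorphism (F \<circ> swap)"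
    using False keller_map_comp[OF F keller_map_automorphism[OF poly_automorphism_swap]]
    by (intro equivariant_keller_automorphism_ordered[of _ w1 w2]) auto
  hence "poly_automorphism (F \<circ> swap \<circ> swap)" using poly_automorphism_comp poly_automorphism_swap by blast
  thus ?thesis by (simp add: comp_assoc swap_swap)
qed

section \<open>Keller maps equivariant for torus actions\<close>

text \<open>
  The linearisation \<open>\<chi>\<close> of the target serves to show that \<open>G\<close> is an automorphism. The target
  coordinates in the conclusion are then \<open>\<psi> = \<phi> \<circ> inv G\<close>, for which the map becomes the identity.
\<close>

theorem theorem3p4:
  fixes G :: plane_map
    and \<theta> \<eta> :: "complex \<Rightarrow> plane_map"
  assumes "keller_map G"
    and "algebraic_action \<theta>"
    and "algebraic_action \<eta>"
    and "nontrivial_action \<theta>"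
    and "\<And>t. t \<noteq> 0 \<Longrightarrow> G \<circ> \<theta> t = \<eta> t \<circ> G"
  shows "poly_automorphism G \<and>
    (\<exists>\<phi> \<psi> w1 w2 v1 v2.
       poly_automorphism \<phi> \<and> poly_automorphism \<psi> \<and>
       (\<forall>t. t \<noteq> 0 \<longrightarrow> diagonal_action w1 w2 t = \<phi> \<circ> \<theta> t \<circ> inv \<phi>) \<and>
       (\<forall>t. t \<noteq> 0 \<longrightarrow> diagonal_action v1 v2 t = \<psi> \<circ> \<eta> t \<circ> inv \<psi>) \<and>
       (elliptic w1 w2 \<longrightarrow>
          triangular_map (\<psi> \<circ> G \<circ> inv \<phi>) \<and>
          (w1 = w2 \<longrightarrow> linear_map (\<psi> \<circ> G \<circ> inv \<phi>))) \<and>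
       (parabolic w1 w2 \<longrightarrow> affine_map (\<psi> \<circ> G \<circ> inv \<phi>)) \<and>
       (hyperbolic w1 w2 \<longrightarrow>
          linear_map (\<psi> \<circ> G \<circ> inv \<phi>) \<and>
          (\<exists>a0 b0. \<psi> \<circ> G \<circ> inv \<phi> = (\<lambda>(x, y). (a0 * x, b0 * y)) \<or>
                   \<psi> \<circ> G \<circ> inv \<phi> = (\<lambda>(x, y). (a0 * y, b0 * x)))))"
proof -
  obtain \<phi> w1 w2 where \<phi>: "poly_automorphism \<phi>"
      and w: "\<And>t. t \<noteq> 0 \<Longrightarrow> diagonal_action w1 w2 t = \<phi> \<circ> \<theta> t \<circ> inv \<phi>"
    using torus_action_linearisable[OF assms(2)] by blast
  obtain \<chi> v1 v2 where \<chi>: "poly_automorphism \<chi>"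
      and v: "\<And>t. t \<noteq> 0 \<Longrightarrow> diagonal_action v1 v2 t = \<chi> \<circ> \<eta> t \<circ> inv \<chi>"
    using torus_action_linearisable[OF assms(3)] by blast
  note \<phi>_inv = poly_automorphism_inv_comp[OF \<phi>] and \<chi>_inv = poly_automorphism_inv_comp[OF \<chi>]
  have "w1 \<noteq> 0 \<or> w2 \<noteq> 0"
  proof (rule ccontr)
    assume "\<not> ?thesis"
    hence diag: "\<phi> \<circ> \<theta> t \<circ> inv \<phi> = id" if "t \<noteq> 0" for t
      using w[OF that] by (auto simp: diagonal_action_def)
    have "\<theta> t = id" if "t \<noteq> 0" for t
    proof -
      have "\<theta> t = (inv \<phi> \<circ> \<phi>) \<circ> \<theta> t \<circ> (inv \<phi> \<circ> \<phi>)" by (simp add: \<phi>_inv)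
      also have "\<dots> = inv \<phi> \<circ> (\<phi> \<circ> \<theta> t \<circ> inv \<phi>) \<circ> \<phi>" by (simp only: comp_assoc)
      finally show ?thesis by (simp only: diag[OF that] comp_id \<phi>_inv)
    qed
    thus False using assms(4) unfolding nontrivial_action_def by blast
  qed
  define F where "F = \<chi> \<circ> G \<circ> inv \<phi>"
  have "F \<circ> diagonal_action w1 w2 t = diagonal_action v1 v2 t \<circ> F" if "t \<noteq> 0" for t
  proof -
    have "F \<circ> diagonal_action w1 w2 t = \<chi> \<circ> G \<circ> (inv \<phi> \<circ> \<phi>) \<circ> \<theta> t \<circ> inv \<phi>"
      by (simp add: F_def w[OF that] comp_assoc)
    also have "\<dots> = \<chi> \<circ> (G \<circ> \<theta> t) \<circ> inv \<phi>" by (simp add: \<phi>_inv comp_assoc)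
    also have "\<dots> = \<chi> \<circ> \<eta> t \<circ> (inv \<chi> \<circ> \<chi>) \<circ> G \<circ> inv \<phi>"
      by (simp add: assms(5)[OF that] \<chi>_inv comp_assoc)
    finally show ?thesis by (simp add: F_def v[OF that] comp_assoc)
  qed
  moreover have "keller_map F"
    unfolding F_def
    by (intro keller_map_comp assms keller_map_automorphism poly_automorphism_inv \<phi> \<chi>)
  ultimately have "poly_automorphism F"
    using equivariant_keller_automorphism \<open>w1 \<noteq> 0 \<or> w2 \<noteq> 0\<close> by blast
  hence "poly_automorphism (inv \<chi> \<circ> F \<circ> \<phi>)"
    by (intro poly_automorphism_comp poly_automorphism_inv \<phi> \<chi>)
  moreover have "inv \<chi> \<circ> F \<circ> \<phi> = (inv \<chi> \<circ> \<chi>) \<circ> G \<circ> (inv \<phi> \<circ> \<phi>)" by (simp add: F_def comp_assoc)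
  ultimately have G: "poly_automorphism G" by (simp add: \<phi>_inv \<chi>_inv)
  note G_inv = poly_automorphism_inv_comp[OF G]
  define \<psi> where "\<psi> = \<phi> \<circ> inv G"
  have \<psi>: "poly_automorphism \<psi>"
    unfolding \<psi>_def by (intro poly_automorphism_comp poly_automorphism_inv \<phi> G)
  have "\<psi> \<circ> G \<circ> inv \<phi> = \<phi> \<circ> (inv G \<circ> G) \<circ> inv \<phi>" by (simp only: \<psi>_def comp_assoc)
  hence "\<psi> \<circ> G \<circ> inv \<phi> = id" by (simp only: G_inv \<phi>_inv comp_id)
  hence id: "\<psi> \<circ> G \<circ> inv \<phi> = (\<lambda>(x, y). (x, y))" by (simp add: id_def)
  hence "inv \<psi> = G \<circ> inv \<phi>"
    using poly_automorphism_inv_comp[OF \<psi>] by (metis comp_assoc comp_id id_comp cond_case_prod_eta id_def)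
  have conj: "diagonal_action w1 w2 t = \<psi> \<circ> \<eta> t \<circ> inv \<psi>" if "t \<noteq> 0" for t
  proof -
    have "\<psi> \<circ> \<eta> t \<circ> inv \<psi> = \<phi> \<circ> inv G \<circ> (\<eta> t \<circ> G) \<circ> inv \<phi>"
      unfolding \<open>inv \<psi> = G \<circ> inv \<phi>\<close> by (simp only: \<psi>_def comp_assoc)
    also have "\<dots> = \<phi> \<circ> (inv G \<circ> G) \<circ> \<theta> t \<circ> inv \<phi>"
      by (simp only: assms(5)[OF that, symmetric] comp_assoc)
    finally show ?thesis by (simp add: G_inv w[OF that])
  qed
  have "triangular_map (\<lambda>(x, y). (x, y))"
    unfolding triangular_map_def by (rule exI[of _ 1], rule exI[of _ 1], rule exI[of _ 0], rule exI[of _ 0]) simp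
  moreover have lin: "linear_map (\<lambda>(x, y). (x, y))"
    unfolding linear_map_def by (rule exI[of _ 1], rule exI[of _ 0], rule exI[of _ 0], rule exI[of _ 1]) simp
  moreover have "affine_map (\<lambda>(x, y). (x, y))"
    unfolding affine_map_def
    by (rule exI[of _ 1], rule exI[of _ 0], rule exI[of _ 0], rule exI[of _ 1], rule exI[of _ 0], rule exI[of _ 0]) simp
  moreover have "\<exists>a0 b0. ((\<lambda>(x, y). (x, y)) :: plane_map) = (\<lambda>(x, y). (a0 * x, b0 * y))"
    by (rule exI[of _ 1], rule exI[of _ 1]) simp
  ultimately show ?thesis
    apply (intro conjI[OF G])
    apply (rule exI[of _ \<phi>], rule exI[of _ \<psi>], rule exI[of _ w1], rule exI[of _ w2],
        rule exI[of _ w1], rule exI[of _ w2])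
    unfolding id using \<phi> \<psi> w conj by blast
qed

end
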